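(* In NF + SCU, the strongly cantorian maps form a system of small maps on $\mathbf{N}$.
   Context: NF is the set theory axiomatised by extensionality and comprehension for stratifiable formulae. Ordered pairs are type-level Quine pairs. $\mathbf{N}$ is the category of all NF sets and all functions whose graphs are sets. A set $x$ is strongly cantorian if $\iota\restriction x=\{\langle y,\{y\}\rangle:y\in x\}$ is a set. SCU is the axiom: the sumset (union) of a strongly cantorian set of strongly cantorian sets is strongly cantorian. A function $f:A\to B$ is a strongly cantorian map if all of its fibres $f^{-1}(b)$, $b\in B$, are strongly cantorian. A system of small maps on a category $\mathbf{C}$ with finite limits, finite coproducts, quotients of kernel pairs and pullback-stable regular epimorphisms is a collection $\mathbf{S}$ of arrows (called small) such that: (i) $\mathbf{S}$ is a subcategory of $\mathbf{C}$ with the same objects as $\mathbf{C}$; (ii) the pullback of a small map along any map is small; (iii) the diagonals $\Delta:C\to C\times C$ are small; (iv) if $f\circ e$ is small and $e$ is a regular epimorphism, then $f$ is small; (v) copairs of small maps are small, i.e. if $f:A\to C$ and $g:B\to C$ are small then so is $[f,g]:A+B\to C$. *)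

theory Defs
  imports Main
begin

section \<open>Categories and systems of small maps\<close>

record ('o, 'm) cat =
  Obj :: "'o set"
  Arr :: "'m set"
  Dom :: "'m \<Rightarrow> 'o"
  Cod :: "'m \<Rightarrow> 'o"
  Ident :: "'o \<Rightarrow> 'm"
  Comp :: "'m \<Rightarrow> 'm \<Rightarrow> 'm" (infixl "\<cdot>\<index>" 70)

definition hom :: "('o, 'm) cat \<Rightarrow> 'o \<Rightarrow> 'o \<Rightarrow> 'm set" where
  "hom C A B = {f \<in> Arr C. Dom C f = A \<and> Cod C f = B}"

text \<open>Composition is in applicative order and only constrained on composable arrows.\<close>

locale category =
  fixes C :: "('o, 'm) cat" (structure)
  assumes Dom_Obj: "f \<in> Arr C \<Longrightarrow> Dom C f \<in> Obj C"
    and Cod_Obj: "f \<in> Arr C \<Longrightarrow> Cod C f \<in> Obj C"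
    and Ident_hom: "A \<in> Obj C \<Longrightarrow> Ident C A \<in> hom C A A"
    and Comp_hom: "f \<in> hom C A B \<Longrightarrow> g \<in> hom C B D \<Longrightarrow> g \<cdot> f \<in> hom C A D"
    and Comp_Ident: "f \<in> hom C A B \<Longrightarrow> f \<cdot> Ident C A = f"
    and Ident_Comp: "f \<in> hom C A B \<Longrightarrow> Ident C B \<cdot> f = f"
    and Comp_assoc: "f \<in> hom C A B \<Longrightarrow> g \<in> hom C B D \<Longrightarrow> h \<in> hom C D E \<Longrightarrow>
      h \<cdot> (g \<cdot> f) = (h \<cdot> g) \<cdot> f"

definition is_functor ::
  "('a, 'b) cat \<Rightarrow> ('o, 'm) cat \<Rightarrow> ('a \<Rightarrow> 'o) \<Rightarrow> ('b \<Rightarrow> 'm) \<Rightarrow> bool" where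
  "is_functor J C Fo Fa \<longleftrightarrow>
     (\<forall>j \<in> Obj J. Fo j \<in> Obj C) \<and>
     (\<forall>u \<in> Arr J. Fa u \<in> hom C (Fo (Dom J u)) (Fo (Cod J u))) \<and>
     (\<forall>j \<in> Obj J. Fa (Ident J j) = Ident C (Fo j)) \<and>
     (\<forall>i j k u v. u \<in> hom J i j \<and> v \<in> hom J j k \<longrightarrow>
        Fa (v \<cdot>\<^bsub>J\<^esub> u) = Fa v \<cdot>\<^bsub>C\<^esub> Fa u)"

definition is_cone ::
  "('o, 'm) cat \<Rightarrow> ('a, 'b) cat \<Rightarrow> ('a \<Rightarrow> 'o) \<Rightarrow> ('b \<Rightarrow> 'm) \<Rightarrow> 'o \<Rightarrow> ('a \<Rightarrow> 'm) \<Rightarrow> bool" where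
  "is_cone C J Fo Fa X p \<longleftrightarrow>
     X \<in> Obj C \<and>
     (\<forall>j \<in> Obj J. p j \<in> hom C X (Fo j)) \<and>
     (\<forall>u \<in> Arr J. Fa u \<cdot>\<^bsub>C\<^esub> p (Dom J u) = p (Cod J u))"

definition is_limit ::
  "('o, 'm) cat \<Rightarrow> ('a, 'b) cat \<Rightarrow> ('a \<Rightarrow> 'o) \<Rightarrow> ('b \<Rightarrow> 'm) \<Rightarrow> 'o \<Rightarrow> ('a \<Rightarrow> 'm) \<Rightarrow> bool" where
  "is_limit C J Fo Fa L p \<longleftrightarrow>
     is_cone C J Fo Fa L p \<and>
     (\<forall>X q. is_cone C J Fo Fa X q \<longrightarrow>
        (\<exists>!k. k \<in> hom C X L \<and> (\<forall>j \<in> Obj J. p j \<cdot>\<^bsub>C\<^esub> k = q j)))"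

text \<open>Every finite category is isomorphic to one whose objects and arrows are natural numbers,
  so it is no restriction to take the index categories (and index sets) in \<open>nat\<close>.\<close>

definition has_finite_limits :: "('o, 'm) cat \<Rightarrow> bool" where
  "has_finite_limits C \<longleftrightarrow>
     (\<forall>(J :: (nat, nat) cat) Fo Fa.
        category J \<and> finite (Obj J) \<and> finite (Arr J) \<and> is_functor J C Fo Fa \<longrightarrow>
        (\<exists>L p. is_limit C J Fo Fa L p))"

definition is_coproduct ::
  "('o, 'm) cat \<Rightarrow> 'i set \<Rightarrow> ('i \<Rightarrow> 'o) \<Rightarrow> 'o \<Rightarrow> ('i \<Rightarrow> 'm) \<Rightarrow> bool" where
  "is_coproduct C I A Q inc \<longleftrightarrow>
     Q \<in> Obj C \<and>
     (\<forall>i \<in> I. inc i \<in> hom C (A i) Q) \<and>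
     (\<forall>X h. X \<in> Obj C \<and> (\<forall>i \<in> I. h i \<in> hom C (A i) X) \<longrightarrow>
        (\<exists>!k. k \<in> hom C Q X \<and> (\<forall>i \<in> I. k \<cdot>\<^bsub>C\<^esub> inc i = h i)))"

definition has_finite_coproducts :: "('o, 'm) cat \<Rightarrow> bool" where
  "has_finite_coproducts C \<longleftrightarrow>
     (\<forall>(I :: nat set) A. finite I \<and> (\<forall>i \<in> I. A i \<in> Obj C) \<longrightarrow>
        (\<exists>Q inc. is_coproduct C I A Q inc))"

definition is_binary_product ::
  "('o, 'm) cat \<Rightarrow> 'o \<Rightarrow> 'o \<Rightarrow> 'o \<Rightarrow> 'm \<Rightarrow> 'm \<Rightarrow> bool" where
  "is_binary_product C A B P p q \<longleftrightarrow>
     p \<in> hom C P A \<and> q \<in> hom C P B \<and>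
     (\<forall>X u v. u \<in> hom C X A \<and> v \<in> hom C X B \<longrightarrow>
        (\<exists>!k. k \<in> hom C X P \<and> p \<cdot>\<^bsub>C\<^esub> k = u \<and> q \<cdot>\<^bsub>C\<^esub> k = v))"

definition is_binary_coproduct ::
  "('o, 'm) cat \<Rightarrow> 'o \<Rightarrow> 'o \<Rightarrow> 'o \<Rightarrow> 'm \<Rightarrow> 'm \<Rightarrow> bool" where
  "is_binary_coproduct C A B Q i j \<longleftrightarrow>
     i \<in> hom C A Q \<and> j \<in> hom C B Q \<and>
     (\<forall>X u v. u \<in> hom C A X \<and> v \<in> hom C B X \<longrightarrow>
        (\<exists>!k. k \<in> hom C Q X \<and> k \<cdot>\<^bsub>C\<^esub> i = u \<and> k \<cdot>\<^bsub>C\<^esub> j = v))"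

text \<open>\<open>is_pullback C f g p q\<close>: the square with \<open>f \<cdot> p = g \<cdot> q\<close> is a pullback, so \<open>q\<close> is the
  pullback of \<open>f\<close> along \<open>g\<close>.\<close>

definition is_pullback :: "('o, 'm) cat \<Rightarrow> 'm \<Rightarrow> 'm \<Rightarrow> 'm \<Rightarrow> 'm \<Rightarrow> bool" where
  "is_pullback C f g p q \<longleftrightarrow>
     (\<exists>A B Z P.
        f \<in> hom C A Z \<and> g \<in> hom C B Z \<and> p \<in> hom C P A \<and> q \<in> hom C P B \<and>
        f \<cdot>\<^bsub>C\<^esub> p = g \<cdot>\<^bsub>C\<^esub> q \<and>
        (\<forall>X u v. u \<in> hom C X A \<and> v \<in> hom C X B \<and> f \<cdot>\<^bsub>C\<^esub> u = g \<cdot>\<^bsub>C\<^esub> v \<longrightarrow>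
           (\<exists>!k. k \<in> hom C X P \<and> p \<cdot>\<^bsub>C\<^esub> k = u \<and> q \<cdot>\<^bsub>C\<^esub> k = v)))"

definition is_coequalizer :: "('o, 'm) cat \<Rightarrow> 'm \<Rightarrow> 'm \<Rightarrow> 'm \<Rightarrow> bool" where
  "is_coequalizer C p q e \<longleftrightarrow>
     (\<exists>A B Q.
        p \<in> hom C A B \<and> q \<in> hom C A B \<and> e \<in> hom C B Q \<and>
        e \<cdot>\<^bsub>C\<^esub> p = e \<cdot>\<^bsub>C\<^esub> q \<and>
        (\<forall>X h. h \<in> hom C B X \<and> h \<cdot>\<^bsub>C\<^esub> p = h \<cdot>\<^bsub>C\<^esub> q \<longrightarrow>
           (\<exists>!k. k \<in> hom C Q X \<and> k \<cdot>\<^bsub>C\<^esub> e = h)))"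

definition is_kernel_pair :: "('o, 'm) cat \<Rightarrow> 'm \<Rightarrow> 'm \<Rightarrow> 'm \<Rightarrow> bool" where
  "is_kernel_pair C f p q \<longleftrightarrow> is_pullback C f f p q"

definition has_quotients_of_kernel_pairs :: "('o, 'm) cat \<Rightarrow> bool" where
  "has_quotients_of_kernel_pairs C \<longleftrightarrow>
     (\<forall>f p q. is_kernel_pair C f p q \<longrightarrow> (\<exists>e. is_coequalizer C p q e))"

definition regular_epi :: "('o, 'm) cat \<Rightarrow> 'm \<Rightarrow> bool" where
  "regular_epi C e \<longleftrightarrow> (\<exists>p q. is_coequalizer C p q e)"

definition has_pullback_stable_regular_epis :: "('o, 'm) cat \<Rightarrow> bool" where
  "has_pullback_stable_regular_epis C \<longleftrightarrow>
     (\<forall>e g p q. regular_epi C e \<and> is_pullback C e g p q \<longrightarrow> regular_epi C q)"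

locale small_map_base = category C for C :: "('o, 'm) cat" (structure) +
  assumes finite_limits: "has_finite_limits C"
    and finite_coproducts: "has_finite_coproducts C"
    and quotients_of_kernel_pairs: "has_quotients_of_kernel_pairs C"
    and pullback_stable_regular_epis: "has_pullback_stable_regular_epis C"

text \<open>Products, coproducts and pullbacks are only determined up to isomorphism; the closure
  conditions are required for every choice of them.\<close>

locale system_of_small_maps = small_map_base C for C :: "('o, 'm) cat" (structure) +
  fixes S :: "'m set"
  assumes small_Arr: "S \<subseteq> Arr C"
    and small_Ident: "A \<in> Obj C \<Longrightarrow> Ident C A \<in> S"
    and small_Comp: "f \<in> S \<Longrightarrow> g \<in> S \<Longrightarrow> Cod C f = Dom C g \<Longrightarrow> g \<cdot> f \<in> S"
    and small_pullback: "f \<in> S \<Longrightarrow> is_pullback C f g p q \<Longrightarrow> q \<in> S"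
    and small_diagonal:
      "is_binary_product C A A P p q \<Longrightarrow> d \<in> hom C A P \<Longrightarrow>
       p \<cdot> d = Ident C A \<Longrightarrow> q \<cdot> d = Ident C A \<Longrightarrow> d \<in> S"
    and small_quotient:
      "e \<in> hom C A B \<Longrightarrow> f \<in> hom C B Z \<Longrightarrow> regular_epi C e \<Longrightarrow> f \<cdot> e \<in> S \<Longrightarrow> f \<in> S"
    and small_copair:
      "f \<in> S \<Longrightarrow> g \<in> S \<Longrightarrow> f \<in> hom C A Z \<Longrightarrow> g \<in> hom C B Z \<Longrightarrow>
       is_binary_coproduct C A B Q i j \<Longrightarrow> h \<in> hom C Q Z \<Longrightarrow>
       h \<cdot> i = f \<Longrightarrow> h \<cdot> j = g \<Longrightarrow> h \<in> S"


section \<open>Formulae of set theory and stratification\<close>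

text \<open>Formulae with named variables; satisfaction is relative to a membership relation on a
  (nonempty) type and an assignment of the variables.\<close>

datatype fm =
    Mem nat nat
  | Eq nat nat
  | Neg fm
  | Conj fm fm
  | All nat fm

primrec sat :: "('v \<Rightarrow> 'v \<Rightarrow> bool) \<Rightarrow> (nat \<Rightarrow> 'v) \<Rightarrow> fm \<Rightarrow> bool" where
  "sat E e (Mem x y) \<longleftrightarrow> E (e x) (e y)"
| "sat E e (Eq x y) \<longleftrightarrow> e x = e y"
| "sat E e (Neg \<phi>) \<longleftrightarrow> \<not> sat E e \<phi>"
| "sat E e (Conj \<phi> \<psi>) \<longleftrightarrow> sat E e \<phi> \<and> sat E e \<psi>"
| "sat E e (All x \<phi>) \<longleftrightarrow> (\<forall>a. sat E (e(x := a)) \<phi>)"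

primrec stratified_by :: "(nat \<Rightarrow> nat) \<Rightarrow> fm \<Rightarrow> bool" where
  "stratified_by s (Mem x y) \<longleftrightarrow> s y = Suc (s x)"
| "stratified_by s (Eq x y) \<longleftrightarrow> s x = s y"
| "stratified_by s (Neg \<phi>) \<longleftrightarrow> stratified_by s \<phi>"
| "stratified_by s (Conj \<phi> \<psi>) \<longleftrightarrow> stratified_by s \<phi> \<and> stratified_by s \<psi>"
| "stratified_by s (All x \<phi>) \<longleftrightarrow> stratified_by s \<phi>"

definition stratifiable :: "fm \<Rightarrow> bool" where
  "stratifiable \<phi> \<longleftrightarrow> (\<exists>s. stratified_by s \<phi>)"


section \<open>Set-theoretic notions of NF\<close>

text \<open>The type \<open>'v\<close> is the universe of a structure for the language of set theory. The HOL
  predicate \<open>is_set P\<close> says that the class \<open>P\<close> is a set of the structure, and \<open>Coll P\<close> then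
  denotes that set (which is unique by extensionality).\<close>

locale membership =
  fixes mem :: "'v \<Rightarrow> 'v \<Rightarrow> bool" (infix "\<epsilon>" 50)
begin

definition is_set :: "('v \<Rightarrow> bool) \<Rightarrow> bool" where
  "is_set P \<longleftrightarrow> (\<exists>z. \<forall>x. x \<epsilon> z \<longleftrightarrow> P x)"

definition Coll :: "('v \<Rightarrow> bool) \<Rightarrow> 'v" where
  "Coll P = (THE z. \<forall>x. x \<epsilon> z \<longleftrightarrow> P x)"

definition empty :: 'v where
  "empty = Coll (\<lambda>x. False)"

definition single :: "'v \<Rightarrow> 'v" where
  "single a = Coll (\<lambda>x. x = a)"

definition adjoin :: "'v \<Rightarrow> 'v \<Rightarrow> 'v" where
  "adjoin a x = Coll (\<lambda>u. u \<epsilon> x \<or> u = a)"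

definition sumset :: "'v \<Rightarrow> 'v" where
  "sumset x = Coll (\<lambda>u. \<exists>y. y \<epsilon> x \<and> u \<epsilon> y)"

text \<open>Frege natural numbers: \<open>n\<close> is the set of all sets with \<open>n\<close> elements.\<close>

definition zero :: 'v where
  "zero = single empty"

definition succ :: "'v \<Rightarrow> 'v" where
  "succ n = Coll (\<lambda>x. \<exists>y a. y \<epsilon> n \<and> \<not> a \<epsilon> y \<and> x = adjoin a y)"

definition Nats :: 'v where
  "Nats = Coll (\<lambda>n. \<forall>A. zero \<epsilon> A \<and> (\<forall>m. m \<epsilon> A \<longrightarrow> succ m \<epsilon> A) \<longrightarrow> n \<epsilon> A)"

text \<open>Quine pairs: \<open>\<langle>x, y\<rangle> = {\<sigma>``a : a \<in> x} \<union> {\<sigma>``b \<union> {0} : b \<in> y}\<close>, where \<open>\<sigma>\<close> is the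
  successor on the natural numbers and the identity on everything else.\<close>

definition shift :: "'v \<Rightarrow> 'v" where
  "shift u = (if u \<epsilon> Nats then succ u else u)"

definition shift_image :: "'v \<Rightarrow> 'v" where
  "shift_image a = Coll (\<lambda>u. \<exists>v. v \<epsilon> a \<and> u = shift v)"

definition pair :: "'v \<Rightarrow> 'v \<Rightarrow> 'v" where
  "pair x y = Coll (\<lambda>u. (\<exists>a. a \<epsilon> x \<and> u = shift_image a) \<or>
                        (\<exists>b. b \<epsilon> y \<and> u = adjoin zero (shift_image b)))"

definition strongly_cantorian :: "'v \<Rightarrow> bool" where
  "strongly_cantorian x \<longleftrightarrow> is_set (\<lambda>p. \<exists>y. y \<epsilon> x \<and> p = pair y (single y))"

definition SCU :: bool where
  "SCU \<longleftrightarrow> (\<forall>x. strongly_cantorian x \<and> (\<forall>y. y \<epsilon> x \<longrightarrow> strongly_cantorian y) \<longrightarrow>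
               strongly_cantorian (sumset x))"

text \<open>An arrow is a triple \<open>(A, f, B)\<close> of a domain, a graph and a codomain.\<close>

definition is_function :: "'v \<Rightarrow> 'v \<Rightarrow> 'v \<Rightarrow> bool" where
  "is_function A f B \<longleftrightarrow>
     (\<forall>p. p \<epsilon> f \<longrightarrow> (\<exists>a b. a \<epsilon> A \<and> b \<epsilon> B \<and> p = pair a b)) \<and>
     (\<forall>a. a \<epsilon> A \<longrightarrow> (\<exists>!b. pair a b \<epsilon> f))"

definition cat_N :: "('v, 'v \<times> 'v \<times> 'v) cat" where
  "cat_N =
     \<lparr> Obj = UNIV,
       Arr = {(A, f, B). is_function A f B},
       Dom = (\<lambda>(A, f, B). A),
       Cod = (\<lambda>(A, f, B). B),
       Ident = (\<lambda>A. (A, Coll (\<lambda>p. \<exists>a. a \<epsilon> A \<and> p = pair a a), A)),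
       Comp = (\<lambda>(B', g, D) (A, f, B).
         (A, Coll (\<lambda>p. \<exists>a b d. pair a b \<epsilon> f \<and> pair b d \<epsilon> g \<and> p = pair a d), D)) \<rparr>"

definition fibre :: "'v \<times> 'v \<times> 'v \<Rightarrow> 'v \<Rightarrow> 'v" where
  "fibre = (\<lambda>(A, f, B) b. Coll (\<lambda>a. a \<epsilon> A \<and> pair a b \<epsilon> f))"

definition strongly_cantorian_maps :: "('v \<times> 'v \<times> 'v) set" where
  "strongly_cantorian_maps =
     {h \<in> Arr cat_N. \<forall>b. b \<epsilon> Cod cat_N h \<longrightarrow> strongly_cantorian (fibre h b)}"

end

text \<open>Models of NF. The assignment \<open>e\<close> supplies the parameters of the comprehension instance.\<close>

locale NF = membership mem for mem :: "'v \<Rightarrow> 'v \<Rightarrow> bool" (infix "\<epsilon>" 50) +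
  assumes extensionality: "(\<forall>x. x \<epsilon> a \<longleftrightarrow> x \<epsilon> b) \<Longrightarrow> a = b"
    and comprehension: "stratifiable \<phi> \<Longrightarrow> is_set (\<lambda>a. sat mem (e(x := a)) \<phi>)"

end

theory Submission
  imports Defs "HOL-Library.Nat_Bijection"
begin

text \<open>The elements of a set \<open>A\<close> are the arrows from a one-element set to \<open>A\<close>, and a class function
  between sets is an arrow as soon as it is given by a stratified term whose value has the same type
  as its argument. For such type-level constructions the category of NF sets behaves like the
  category of sets: limits are sets of families, coproducts are disjoint unions, the regular
  epimorphisms are the surjections, and a pullback consists of the pairs of elements that agree
  (\<open>pullback_elements\<close>, \<open>coequalizer_surjective\<close>, \<open>surjective_regular_epi\<close>). The one classical
  construction that is not type-level is the set of equivalence classes; but the quotient of a kernel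
  pair is the image of the map that it comes from (\<open>quotients_N\<close>).

  The closure properties of strongly cantorian maps become statements about fibres. If \<open>x\<close> is
  strongly cantorian, then from \<open>a \<in> x\<close> one can pass to \<open>{a}\<close> without changing type, and therefore
  from \<open>F(a)\<close> to \<open>{F(a)}\<close>, for every stratified \<open>F\<close>. So images of strongly cantorian sets are strongly
  cantorian (\<open>sc_image_general\<close>), even under a map that raises types. Pullbacks, diagonals, quotients
  and copairs only need images, subsets and binary unions. The fibre of a composite \<open>g \<cdot> f\<close> over
  \<open>d\<close> is the sumset of the family of the fibres of \<open>f\<close> over the points of the fibre of \<open>g\<close> over
  \<open>d\<close>. This family is the image of a strongly cantorian set under the type-raising map
  \<open>b \<mapsto> f\<^sup>-\<^sup>1(b)\<close>, and SCU applies to it (\<open>sc_map_Comp\<close>).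

  All of this rests on Quine pairs being pairs, that is, on the successor being injective on the Frege
  numbers, that is, on the axiom of infinity (\<open>V_infinite\<close>), a theorem of NF due to Specker. The
  proof is a parity argument. Suppose that the universe \<open>V\<close> is finite. Write \<open>T |x|\<close> for the
  cardinal of the set of singletons of elements of \<open>x\<close>; the cardinal of the power set of \<open>x\<close> is
  then \<open>2\<^bsup>T |x|\<^esup>\<close>. Since \<open>V\<close> is its own power set, \<open>|V| = 2\<^bsup>T |V|\<^esup>\<close>. Take logarithms to base 2,
  starting at \<open>|V|\<close>, for as long as they exist, and let \<open>H\<close> be the finite set of the numbers
  obtained. The first step leads to \<open>T |V|\<close>, and as \<open>T\<close> commutes with exponentiation, the rest of
  the chain is the image of the whole chain under \<open>T\<close>: \<open>H\<close> is the disjoint union of \<open>{|V|}\<close> and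
  \<open>T``H\<close>. Hence \<open>|H| = T |H| + 1\<close>, but \<open>T\<close> preserves parity.

  Comprehension is available for stratified formulae only. To avoid writing formulae, the predicates
  and terms that they define are closed under the logical operations by introduction rules
  (\<open>strat_intros\<close>); applying these rules to a predicate amounts to finding its stratification, with the
  types left to unification.\<close>

section \<open>Stratified predicates and terms\<close>

primrec rename :: "(nat \<Rightarrow> nat) \<Rightarrow> fm \<Rightarrow> fm" where
  "rename r (Mem x y) = Mem (r x) (r y)"
| "rename r (Eq x y) = Eq (r x) (r y)"
| "rename r (Neg \<phi>) = Neg (rename r \<phi>)"
| "rename r (Conj \<phi> \<psi>) = Conj (rename r \<phi>) (rename r \<psi>)"
| "rename r (All x \<phi>) = All (r x) (rename r \<phi>)"

lemma sat_rename:
  assumes "inj r"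
  shows "sat E e (rename r \<phi>) \<longleftrightarrow> sat E (e \<circ> r) \<phi>"
proof (induction \<phi> arbitrary: e)
  case (All x \<phi>)
  have "(e(r x := a)) \<circ> r = (e \<circ> r)(x := a)" for a
    using assms by (auto simp: fun_eq_iff inj_eq)
  then show ?case by (simp add: All del: fun_upd_apply o_apply)
qed auto

lemma stratified_by_rename: "stratified_by s (rename r \<phi>) \<longleftrightarrow> stratified_by (s \<circ> r) \<phi>"
  by (induction \<phi>) auto

text \<open>Formulae have one sort of variables, the natural numbers. These are read as elements of
  \<open>nat + nat\<close>: the left summand holds the variables on which a predicate depends, the right
  summand an unlimited supply of parameters and bound variables.\<close>

definition rename_sum :: "(nat + nat \<Rightarrow> nat + nat) \<Rightarrow> fm \<Rightarrow> fm" where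
  "rename_sum r = rename (sum_encode \<circ> r \<circ> sum_decode)"

lemma sat_rename_sum:
  assumes "inj r"
  shows "sat E (e \<circ> sum_decode) (rename_sum r \<phi>) \<longleftrightarrow> sat E (e \<circ> r \<circ> sum_decode) \<phi>"
proof -
  have "inj (sum_encode \<circ> r \<circ> sum_decode)"
    by (intro inj_compose assms inj_sum_encode inj_sum_decode)
  then show ?thesis
    by (simp add: rename_sum_def sat_rename comp_assoc) (simp add: comp_def)
qed

lemma stratified_by_rename_sum:
  "stratified_by (s \<circ> sum_decode) (rename_sum r \<phi>) \<longleftrightarrow> stratified_by (s \<circ> r \<circ> sum_decode) \<phi>"
  by (simp add: rename_sum_def stratified_by_rename comp_def)

context membership
begin

text \<open>The predicate \<open>P\<close> of assignments is defined by a formula that is stratified when variable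
  \<open>i\<close> has type \<open>\<Gamma> i\<close>. The values \<open>\<pi>\<close> of the parameters, and their types \<open>s\<close>, are hidden: as
  different variables may denote the same object, a parameter may be used at several types.
  Variables are de Bruijn indices, so that a quantifier extends \<open>\<Gamma>\<close> to \<open>case_nat t \<Gamma>\<close>, and
  substitution under a binder becomes beta reduction.\<close>

definition strat_pred :: "(nat \<Rightarrow> nat) \<Rightarrow> ((nat \<Rightarrow> 'v) \<Rightarrow> bool) \<Rightarrow> bool" where
  "strat_pred \<Gamma> P \<longleftrightarrow> (\<exists>\<phi> s \<pi>. stratified_by (case_sum \<Gamma> s \<circ> sum_decode) \<phi> \<and>
     (\<forall>e. sat mem (case_sum e \<pi> \<circ> sum_decode) \<phi> \<longleftrightarrow> P e))"

definition strat_term :: "(nat \<Rightarrow> nat) \<Rightarrow> nat \<Rightarrow> ((nat \<Rightarrow> 'v) \<Rightarrow> 'v) \<Rightarrow> bool" where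
  "strat_term \<Gamma> t f \<longleftrightarrow> strat_pred (case_nat t \<Gamma>) (\<lambda>e. e 0 = f (\<lambda>i. e (Suc i)))"

text \<open>A copy of the equation \<open>\<Gamma> i = t\<close> that only the two rules below take apart, so that unknown
  types are found by unification.\<close>

definition var_has_type :: "(nat \<Rightarrow> nat) \<Rightarrow> nat \<Rightarrow> nat \<Rightarrow> bool" where
  "var_has_type \<Gamma> i t \<longleftrightarrow> \<Gamma> i = t"

lemma var_has_type_0: "var_has_type (case_nat t \<Gamma>) 0 t"
  and var_has_type_Suc: "var_has_type \<Gamma> i t \<Longrightarrow> var_has_type (case_nat u \<Gamma>) (Suc i) t"
  by (simp_all add: var_has_type_def)

lemma strat_pred_rename:
  assumes "strat_pred \<Gamma> P" "inj r" "\<Gamma>' \<circ> r = \<Gamma>"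
  shows "strat_pred \<Gamma>' (\<lambda>e. P (e \<circ> r))"
proof -
  obtain \<phi> s \<pi> where *: "stratified_by (case_sum \<Gamma> s \<circ> sum_decode) \<phi>"
    "\<And>e. sat mem (case_sum e \<pi> \<circ> sum_decode) \<phi> \<longleftrightarrow> P e"
    using assms(1) unfolding strat_pred_def by blast
  let ?r = "map_sum r id"
  have inj: "inj ?r" using assms(2) by (simp add: sum.inj_map)
  have eq: "case_sum e p \<circ> ?r = case_sum (e \<circ> r) p" for e :: "nat \<Rightarrow> 'x" and p
    by (auto simp: fun_eq_iff split: sum.split)
  show ?thesis unfolding strat_pred_def
    by (intro exI[of _ "rename_sum ?r \<phi>"] exI[of _ s] exI[of _ \<pi>])
      (simp add: stratified_by_rename_sum sat_rename_sum[OF inj] eq * assms(3))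
qed

text \<open>A new variable enters at index 1, just above the innermost one.\<close>

lemma strat_pred_weaken1:
  assumes "strat_pred (case_nat t \<Gamma>) (\<lambda>e. P (\<lambda>i. e (Suc i)) (e 0))"
  shows "strat_pred (case_nat t (case_nat u \<Gamma>)) (\<lambda>e. P (\<lambda>i. e (Suc (Suc i))) (e 0))"
proof -
  let ?r = "case_nat 0 (\<lambda>i. Suc (Suc i))"
  have "inj ?r" by (auto simp: inj_def split: nat.splits)
  moreover have "case_nat t (case_nat u \<Gamma>) \<circ> ?r = case_nat t \<Gamma>"
    by (auto simp: fun_eq_iff split: nat.split)
  ultimately show ?thesis
    using strat_pred_rename[OF assms, of ?r "case_nat t (case_nat u \<Gamma>)"] by (simp add: comp_def)
qed

lemma strat_term_weaken: "strat_term \<Gamma> t f \<Longrightarrow> strat_term (case_nat u \<Gamma>) t (\<lambda>e. f (\<lambda>i. e (Suc i)))"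
  unfolding strat_term_def by (rule strat_pred_weaken1)

lemma strat_pred_const: "strat_pred \<Gamma> (\<lambda>e. B)"
  unfolding strat_pred_def
  by (rule exI[of _ "if B then All 0 (Eq 0 0) else Neg (All 0 (Eq 0 0))"]) simp

lemma strat_pred_Not: "strat_pred \<Gamma> P \<Longrightarrow> strat_pred \<Gamma> (\<lambda>e. \<not> P e)"
  unfolding strat_pred_def by (metis sat.simps(3) stratified_by.simps(3))

text \<open>The parameters of the two formulae are kept apart by giving them even and odd numbers.\<close>

lemma strat_pred_conj:
  assumes "strat_pred \<Gamma> P" "strat_pred \<Gamma> Q"
  shows "strat_pred \<Gamma> (\<lambda>e. P e \<and> Q e)"
proof -
  obtain \<phi> s \<pi> where 1: "stratified_by (case_sum \<Gamma> s \<circ> sum_decode) \<phi>"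
    "\<And>e. sat mem (case_sum e \<pi> \<circ> sum_decode) \<phi> \<longleftrightarrow> P e"
    using assms(1) unfolding strat_pred_def by blast
  obtain \<psi> t \<rho> where 2: "stratified_by (case_sum \<Gamma> t \<circ> sum_decode) \<psi>"
    "\<And>e. sat mem (case_sum e \<rho> \<circ> sum_decode) \<psi> \<longleftrightarrow> Q e"
    using assms(2) unfolding strat_pred_def by blast
  let ?r1 = "map_sum id (\<lambda>n. 2 * n) :: nat + nat \<Rightarrow> _"
    and ?r2 = "map_sum id (\<lambda>n. Suc (2 * n)) :: nat + nat \<Rightarrow> _"
  let ?m = "\<lambda>p q n. if even n then p (n div 2) else q (n div 2)"
  have inj: "inj ?r1" "inj ?r2" by (intro sum.inj_map; simp add: inj_def)+
  have eq: "case_sum e (?m p q) \<circ> ?r1 = case_sum e p" "case_sum e (?m p q) \<circ> ?r2 = case_sum e q"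
    for e :: "nat \<Rightarrow> 'x" and p q
    by (auto simp: fun_eq_iff split: sum.split)
  show ?thesis unfolding strat_pred_def
    by (intro exI[of _ "Conj (rename_sum ?r1 \<phi>) (rename_sum ?r2 \<psi>)"] exI[of _ "?m s t"]
        exI[of _ "?m \<pi> \<rho>"])
      (simp add: stratified_by_rename_sum sat_rename_sum[OF inj(1)] sat_rename_sum[OF inj(2)] eq 1 2)
qed

text \<open>The innermost variable is turned into a parameter, the first one, which the quantifier can
  then bind.\<close>

lemma strat_pred_all:
  assumes "strat_pred (case_nat t \<Gamma>) (\<lambda>e. P (\<lambda>i. e (Suc i)) (e 0))"
  shows "strat_pred \<Gamma> (\<lambda>e. \<forall>x. P e x)"
proof -
  obtain \<phi> s \<pi> where *: "stratified_by (case_sum (case_nat t \<Gamma>) s \<circ> sum_decode) \<phi>"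
    "\<And>e. sat mem (case_sum e \<pi> \<circ> sum_decode) \<phi> \<longleftrightarrow> P (\<lambda>i. e (Suc i)) (e 0)"
    using assms unfolding strat_pred_def by blast
  let ?r = "case_sum (case_nat (Inr 0) Inl) (\<lambda>k. Inr (Suc k))"
  have inj: "inj ?r" by (auto simp: inj_def split: sum.splits nat.splits)
  have eq: "case_sum e (case_nat a p) \<circ> ?r = case_sum (case_nat a e) p"
    for e :: "nat \<Rightarrow> 'x" and p a
    by (auto simp: fun_eq_iff split: sum.split nat.split)
  have upd: "(case_sum e (case_nat b \<pi>) \<circ> sum_decode)(sum_encode (Inr 0) := a) =
      case_sum e (case_nat a \<pi>) \<circ> sum_decode" for e :: "nat \<Rightarrow> 'v" and a b
  proof
    fix n
    show "((case_sum e (case_nat b \<pi>) \<circ> sum_decode)(sum_encode (Inr 0) := a)) n =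
      (case_sum e (case_nat a \<pi>) \<circ> sum_decode) n"
    proof (cases "n = sum_encode (Inr 0)")
      case True
      then show ?thesis by (simp del: sum_encode_def)
    next
      case False
      then have "sum_decode n \<noteq> Inr 0" by (metis sum_decode_inverse)
      with False show ?thesis
        by (simp del: sum_encode_def split: sum.split nat.split)
    qed
  qed
  show ?thesis unfolding strat_pred_def
    by (intro exI[of _ "All (sum_encode (Inr 0)) (rename_sum ?r \<phi>)"] exI[of _ "case_nat t s"]
        exI[of _ "case_nat undefined \<pi>"])
      (simp add: stratified_by_rename_sum sat_rename_sum[OF inj] upd eq *)
qed

lemma strat_pred_ex:
  assumes "strat_pred (case_nat t \<Gamma>) (\<lambda>e. P (\<lambda>i. e (Suc i)) (e 0))"
  shows "strat_pred \<Gamma> (\<lambda>e. \<exists>x. P e x)"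
  using strat_pred_Not[OF strat_pred_all[where P = "\<lambda>e x. \<not> P e x", OF strat_pred_Not[OF assms]]]
  by simp

lemma strat_pred_disj: "strat_pred \<Gamma> P \<Longrightarrow> strat_pred \<Gamma> Q \<Longrightarrow> strat_pred \<Gamma> (\<lambda>e. P e \<or> Q e)"
  using strat_pred_Not[OF strat_pred_conj[OF strat_pred_Not[of \<Gamma> P] strat_pred_Not[of \<Gamma> Q]]] by simp

lemma strat_pred_imp: "strat_pred \<Gamma> P \<Longrightarrow> strat_pred \<Gamma> Q \<Longrightarrow> strat_pred \<Gamma> (\<lambda>e. P e \<longrightarrow> Q e)"
  unfolding imp_conv_disj by (intro strat_pred_disj strat_pred_Not)

lemma strat_pred_iff: "strat_pred \<Gamma> P \<Longrightarrow> strat_pred \<Gamma> Q \<Longrightarrow> strat_pred \<Gamma> (\<lambda>e. P e \<longleftrightarrow> Q e)"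
  unfolding iff_conv_conj_imp by (intro strat_pred_conj strat_pred_imp)

text \<open>A quantifier over a finite index set of the metatheory is a finite conjunction; this is
  what makes limits of diagrams of standard finite size available.\<close>

lemma strat_pred_finite_all:
  "finite I \<Longrightarrow> (\<And>i. i \<in> I \<Longrightarrow> strat_pred \<Gamma> (P i)) \<Longrightarrow> strat_pred \<Gamma> (\<lambda>e. \<forall>i\<in>I. P i e)"
proof (induction I rule: finite_induct)
  case empty
  then show ?case by (simp add: strat_pred_const)
next
  case (insert i I)
  then show ?case using strat_pred_conj[of \<Gamma> "P i" "\<lambda>e. \<forall>i\<in>I. P i e"] by simp
qed

lemma strat_pred_finite_ex:
  "finite I \<Longrightarrow> (\<And>i. i \<in> I \<Longrightarrow> strat_pred \<Gamma> (P i)) \<Longrightarrow> strat_pred \<Gamma> (\<lambda>e. \<exists>i\<in>I. P i e)"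
  using strat_pred_Not[OF strat_pred_finite_all[of I \<Gamma> "\<lambda>i e. \<not> P i e"]] strat_pred_Not by simp

lemma strat_term_var: "var_has_type \<Gamma> i t \<Longrightarrow> strat_term \<Gamma> t (\<lambda>e. e i)"
  unfolding strat_term_def strat_pred_def var_has_type_def
  by (rule exI[of _ "Eq (sum_encode (Inl 0)) (sum_encode (Inl (Suc i)))"])
    (simp del: sum_encode_def)

lemma strat_term_const: "strat_term \<Gamma> t (\<lambda>e. c)"
  unfolding strat_term_def strat_pred_def
  by (intro exI[of _ "Eq (sum_encode (Inl 0)) (sum_encode (Inr 0))"] exI[of _ "\<lambda>_. t"]
      exI[of _ "\<lambda>_. c"])
    (simp del: sum_encode_def)

lemma strat_pred_Eq:
  assumes "strat_term \<Gamma> t f" "strat_term \<Gamma> t g"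
  shows "strat_pred \<Gamma> (\<lambda>e. f e = g e)"
proof -
  have "strat_pred \<Gamma> (\<lambda>e. \<exists>x. x = f e \<and> x = g e)"
    using assms unfolding strat_term_def by (intro strat_pred_ex strat_pred_conj)
  then show ?thesis by simp
qed

lemma strat_pred_Mem:
  assumes "strat_term \<Gamma> t f" "strat_term \<Gamma> (Suc t) g"
  shows "strat_pred \<Gamma> (\<lambda>e. f e \<epsilon> g e)"
proof -
  have "strat_pred (case_nat (Suc t) (case_nat t \<Gamma>)) (\<lambda>e. e (Suc 0) \<epsilon> e 0)"
    unfolding strat_pred_def
    by (rule exI[of _ "Mem (sum_encode (Inl (Suc 0))) (sum_encode (Inl 0))"])
      (simp del: sum_encode_def)
  then have "strat_pred \<Gamma> (\<lambda>e. \<exists>x. x = f e \<and> (\<exists>y. y = g e \<and> x \<epsilon> y))"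
    using assms(1) strat_term_weaken[OF assms(2), of t] unfolding strat_term_def
    by (intro strat_pred_ex strat_pred_conj)
  then show ?thesis by simp
qed

text \<open>A term may be substituted for a variable of its type, because \<open>P (f e)\<close> is equivalent to
  \<open>\<exists>x. x = f e \<and> P x\<close>.\<close>

lemma strat_pred_let:
  assumes "strat_pred (case_nat t \<Gamma>) (\<lambda>e. H (\<lambda>i. e (Suc i)) (e 0))" "strat_term \<Gamma> t f"
  shows "strat_pred \<Gamma> (\<lambda>e. H e (f e))"
proof -
  have "strat_pred \<Gamma> (\<lambda>e. \<exists>x. x = f e \<and> H e x)"
    using assms unfolding strat_term_def by (intro strat_pred_ex strat_pred_conj)
  then show ?thesis by simp
qed

lemma strat_pred_subst2:
  assumes "strat_pred (case_nat s (case_nat t \<Gamma>)) (\<lambda>e. H (e (Suc 0)) (e 0))"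
    "strat_term \<Gamma> t f" "strat_term \<Gamma> s g"
  shows "strat_pred \<Gamma> (\<lambda>e. H (f e) (g e))"
proof -
  have "strat_pred (case_nat t \<Gamma>) (\<lambda>e. H (e 0) (g (\<lambda>i. e (Suc i))))"
    using strat_pred_let[where H = "\<lambda>e. H (e 0)", OF assms(1) strat_term_weaken[OF assms(3)]] .
  from strat_pred_let[where H = "\<lambda>e x. H x (g e)", OF this assms(2)] show ?thesis .
qed

lemma strat_term_let:
  assumes "strat_term (case_nat t \<Gamma>) u (\<lambda>e. H (\<lambda>i. e (Suc i)) (e 0))" "strat_term \<Gamma> t f"
  shows "strat_term \<Gamma> u (\<lambda>e. H e (f e))"
proof -
  let ?r = "case_nat (Suc 0) (case_nat 0 (\<lambda>i. Suc (Suc i)))"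
  have "inj ?r" by (auto simp: inj_def split: nat.splits)
  moreover have "case_nat t (case_nat u \<Gamma>) \<circ> ?r = case_nat u (case_nat t \<Gamma>)"
    by (auto simp: fun_eq_iff split: nat.split)
  ultimately have "strat_pred (case_nat t (case_nat u \<Gamma>)) (\<lambda>e. e (Suc 0) = H (\<lambda>i. e (Suc (Suc i))) (e 0))"
    using strat_pred_rename[OF assms(1)[unfolded strat_term_def], of ?r "case_nat t (case_nat u \<Gamma>)"]
    by (simp add: comp_def)
  then have "strat_pred (case_nat u \<Gamma>) (\<lambda>e. \<exists>x. x = f (\<lambda>i. e (Suc i)) \<and> e 0 = H (\<lambda>i. e (Suc i)) x)"
    using strat_term_weaken[OF assms(2), of u] unfolding strat_term_def
    by (intro strat_pred_ex strat_pred_conj)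
  then show ?thesis unfolding strat_term_def by simp
qed

lemma strat_term_subst:
  assumes "strat_term (case_nat t \<Gamma>) u (\<lambda>e. H (e 0))" "strat_term \<Gamma> t f"
  shows "strat_term \<Gamma> u (\<lambda>e. H (f e))"
  using strat_term_let[where H = "\<lambda>_. H", OF assms] .

text \<open>An operation needs to be checked on variables only; the rules for compound terms follow.\<close>

lemma strat_term_subst2:
  assumes "strat_term (case_nat s (case_nat t \<Gamma>)) u (\<lambda>e. H (e (Suc 0)) (e 0))"
    "strat_term \<Gamma> t f" "strat_term \<Gamma> s g"
  shows "strat_term \<Gamma> u (\<lambda>e. H (f e) (g e))"
proof -
  have "strat_term (case_nat t \<Gamma>) u (\<lambda>e. H (e 0) (g (\<lambda>i. e (Suc i))))"
    using strat_term_let[where H = "\<lambda>e. H (e 0)", OF assms(1) strat_term_weaken[OF assms(3)]] .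
  from strat_term_let[where H = "\<lambda>e x. H x (g e)", OF this assms(2)] show ?thesis .
qed

lemma strat_term_If:
  assumes "strat_pred \<Gamma> B" "strat_term \<Gamma> t f" "strat_term \<Gamma> t g"
  shows "strat_term \<Gamma> t (\<lambda>e. if B e then f e else g e)"
proof -
  have "strat_pred (case_nat t \<Gamma>) (\<lambda>e. B (\<lambda>i. e (Suc i)))"
    using strat_pred_rename[OF assms(1), of Suc "case_nat t \<Gamma>"] by (simp add: comp_def)
  then have "strat_pred (case_nat t \<Gamma>) (\<lambda>e. (B (\<lambda>i. e (Suc i)) \<and> e 0 = f (\<lambda>i. e (Suc i))) \<or>
      (\<not> B (\<lambda>i. e (Suc i)) \<and> e 0 = g (\<lambda>i. e (Suc i))))"
    using assms(2,3) unfolding strat_term_def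
    by (intro strat_pred_conj strat_pred_disj strat_pred_Not)
  moreover have "(\<lambda>e. (B (\<lambda>i. e (Suc i)) \<and> e 0 = f (\<lambda>i. e (Suc i))) \<or>
      (\<not> B (\<lambda>i. e (Suc i)) \<and> e 0 = g (\<lambda>i. e (Suc i)))) = 
     (\<lambda>e. e 0 = (if B (\<lambda>i. e (Suc i)) then f (\<lambda>i. e (Suc i)) else g (\<lambda>i. e (Suc i))))"
    by auto
  ultimately show ?thesis unfolding strat_term_def by simp
qed


end

context NF
begin

lemma is_set_Str:
  assumes "strat_pred (case_nat t \<Gamma>) (\<lambda>e. P (\<lambda>i. e (Suc i)) (e 0))"
  shows "is_set (P e)"
proof -
  obtain \<phi> s \<pi> where *: "stratified_by (case_sum (case_nat t \<Gamma>) s \<circ> sum_decode) \<phi>"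
    "\<And>e. sat mem (case_sum e \<pi> \<circ> sum_decode) \<phi> \<longleftrightarrow> P (\<lambda>i. e (Suc i)) (e 0)"
    using assms unfolding strat_pred_def by blast
  let ?x = "sum_encode (Inl 0)"
  let ?e = "case_sum (case_nat undefined e) \<pi> \<circ> sum_decode"
  have "?e(?x := a) = case_sum (case_nat a e) \<pi> \<circ> sum_decode" for a
  proof
    fix n
    show "(?e(?x := a)) n = (case_sum (case_nat a e) \<pi> \<circ> sum_decode) n"
    proof (cases "n = ?x")
      case True
      then show ?thesis by (simp del: sum_encode_def)
    next
      case False
      then have "sum_decode n \<noteq> Inl 0" by (metis sum_decode_inverse)
      with False show ?thesis
        by (simp del: sum_encode_def split: sum.split nat.split)
    qed
  qed
  then have "sat mem (?e(?x := a)) \<phi> \<longleftrightarrow> P e a" for a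
    using *(2) by simp
  moreover have "is_set (\<lambda>a. sat mem (?e(?x := a)) \<phi>)"
    using *(1) by (intro comprehension) (auto simp: stratifiable_def)
  ultimately show ?thesis by simp
qed

text \<open>Stratified comprehension. The variables beyond the comprehended one do not occur in \<open>P\<close>;
  they are given type 0.\<close>

lemma is_setI: "strat_pred (case_nat t (\<lambda>_. 0)) (\<lambda>e. P (e 0)) \<Longrightarrow> is_set P"
  by (rule is_set_Str[where P = "\<lambda>_. P"])

lemma set_ext: "(\<And>x. x \<epsilon> a \<longleftrightarrow> x \<epsilon> b) \<Longrightarrow> a = b"
  by (rule extensionality) simp

lemma Coll_iff: "is_set P \<Longrightarrow> x \<epsilon> Coll P \<longleftrightarrow> P x"
proof -
  assume "is_set P"
  then obtain z where z: "\<forall>x. x \<epsilon> z \<longleftrightarrow> P x" unfolding is_set_def by blast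
  have "\<forall>x. x \<epsilon> Coll P \<longleftrightarrow> P x"
    unfolding Coll_def by (rule theI[of _ z]) (use z in \<open>auto intro: set_ext\<close>)
  then show ?thesis by simp
qed

text \<open>\<open>z = {x. P x}\<close> unfolds to \<open>\<forall>x. x \<in> z \<longleftrightarrow> P x\<close> because \<open>{x. P x}\<close> is indeed a set.\<close>

lemma strat_term_Coll:
  assumes "strat_pred (case_nat t \<Gamma>) (\<lambda>e. P (\<lambda>i. e (Suc i)) (e 0))"
  shows "strat_term \<Gamma> (Suc t) (\<lambda>e. Coll (P e))"
proof -
  have "strat_pred (case_nat t (case_nat (Suc t) \<Gamma>)) (\<lambda>e. P (\<lambda>i. e (Suc (Suc i))) (e 0))"
    using assms by (rule strat_pred_weaken1)
  moreover have "strat_pred (case_nat t (case_nat (Suc t) \<Gamma>)) (\<lambda>e. e 0 \<epsilon> e (Suc 0))"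
    by (rule strat_pred_Mem strat_term_var var_has_type_0 var_has_type_Suc)+
  ultimately have "strat_pred (case_nat (Suc t) \<Gamma>) (\<lambda>e. \<forall>x. x \<epsilon> e 0 \<longleftrightarrow> P (\<lambda>i. e (Suc i)) x)"
    by (intro strat_pred_all strat_pred_iff)
  moreover have "z = Coll (P e) \<longleftrightarrow> (\<forall>x. x \<epsilon> z \<longleftrightarrow> P e x)" for z e
    by (auto simp: Coll_iff[OF is_set_Str[OF assms]] intro: set_ext)
  ultimately show ?thesis unfolding strat_term_def by (simp only:)
qed

lemmas strat_intros = is_setI strat_pred_const strat_pred_Not strat_pred_conj strat_pred_disj
  strat_pred_imp strat_pred_iff strat_pred_all strat_pred_ex
  strat_pred_Eq strat_pred_Mem strat_term_const strat_term_var strat_term_If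
  strat_term_Coll var_has_type_0 var_has_type_Suc

lemma strat_term_single: "strat_term \<Gamma> t f \<Longrightarrow> strat_term \<Gamma> (Suc t) (\<lambda>e. single (f e))"
  by (rule strat_term_subst[where H = single], unfold single_def) (rule strat_intros | assumption)+

lemma strat_term_adjoin:
  "strat_term \<Gamma> t f \<Longrightarrow> strat_term \<Gamma> (Suc t) g \<Longrightarrow> strat_term \<Gamma> (Suc t) (\<lambda>e. adjoin (f e) (g e))"
  by (rule strat_term_subst2[where H = adjoin], unfold adjoin_def) (rule strat_intros | assumption)+

text \<open>Each operation is stratified from the least type on at which the variables bound in its
  definition have types, whence the lower bounds in this and the following rules.\<close>

lemma strat_term_succ: "strat_term \<Gamma> (Suc (Suc t)) f \<Longrightarrow> strat_term \<Gamma> (Suc (Suc t)) (\<lambda>e. succ (f e))"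
  by (rule strat_term_subst[where H = succ], unfold succ_def)
    (rule strat_intros strat_term_adjoin | assumption)+

lemma Nats_set: "is_set (\<lambda>n. \<forall>A. zero \<epsilon> A \<and> (\<forall>m. m \<epsilon> A \<longrightarrow> succ m \<epsilon> A) \<longrightarrow> n \<epsilon> A)"
  by (rule strat_intros strat_term_succ)+

lemma strat_term_shift:
  "strat_term \<Gamma> (Suc (Suc t)) f \<Longrightarrow> strat_term \<Gamma> (Suc (Suc t)) (\<lambda>e. shift (f e))"
  by (rule strat_term_subst[where H = shift], unfold shift_def)
    (rule strat_intros strat_term_succ | assumption)+

lemma strat_term_shift_image:
  "strat_term \<Gamma> (Suc (Suc (Suc t))) f \<Longrightarrow> strat_term \<Gamma> (Suc (Suc (Suc t))) (\<lambda>e. shift_image (f e))"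
  by (rule strat_term_subst[where H = shift_image], unfold shift_image_def)
    (rule strat_intros strat_term_shift | assumption)+

lemma strat_term_pair:
  "strat_term \<Gamma> (Suc (Suc (Suc (Suc t)))) f \<Longrightarrow> strat_term \<Gamma> (Suc (Suc (Suc (Suc t)))) g \<Longrightarrow>
    strat_term \<Gamma> (Suc (Suc (Suc (Suc t)))) (\<lambda>e. pair (f e) (g e))"
  by (rule strat_term_subst2[where H = pair], unfold pair_def)
    (rule strat_intros strat_term_shift_image strat_term_adjoin | assumption)+

lemma strat_term_sumset: "strat_term \<Gamma> (Suc (Suc t)) f \<Longrightarrow> strat_term \<Gamma> (Suc t) (\<lambda>e. sumset (f e))"
  by (rule strat_term_subst[where H = sumset], unfold sumset_def) (rule strat_intros | assumption)+

lemma is_set_bounded: "is_set (\<lambda>x. x \<epsilon> a)" by (auto simp: is_set_def)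


section \<open>Finite sets\<close>

definition included :: "'v \<Rightarrow> 'v \<Rightarrow> bool" where
  "included x y \<longleftrightarrow> (\<forall>u. u \<epsilon> x \<longrightarrow> u \<epsilon> y)"

definition remove :: "'v \<Rightarrow> 'v \<Rightarrow> 'v" where
  "remove a x = Coll (\<lambda>u. u \<epsilon> x \<and> u \<noteq> a)"

definition image_set :: "('v \<Rightarrow> 'v) \<Rightarrow> 'v \<Rightarrow> 'v" where
  "image_set F x = Coll (\<lambda>v. \<exists>u. u \<epsilon> x \<and> v = F u)"

text \<open>A pair has type at least 4, and a family that is coded by a set of pairs has type at least
  5, whence the bound on the type of the argument.\<close>

definition homogeneous :: "('v \<Rightarrow> 'v) \<Rightarrow> bool" where
  "homogeneous F \<longleftrightarrow> (\<forall>\<Gamma> t. strat_term (case_nat (Suc (Suc (Suc (Suc (Suc t))))) \<Gamma>)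
     (Suc (Suc (Suc (Suc (Suc t))))) (\<lambda>e. F (e 0)))"

definition singletons :: "'v \<Rightarrow> 'v" where
  "singletons x = image_set single x"

definition power_set :: "'v \<Rightarrow> 'v" where
  "power_set x = Coll (\<lambda>u. included u x)"

definition V :: 'v where
  "V = Coll (\<lambda>_. True)"

definition is_finite :: "'v \<Rightarrow> bool" where
  "is_finite x \<longleftrightarrow> (\<exists>n. n \<epsilon> Nats \<and> x \<epsilon> n)"

text \<open>Equinumerosity of finite sets, in terms of Frege numbers. It is defined without
  bijections, since ordered pairs of the same type as their components become available only
  after the axiom of infinity has been derived.\<close>

definition equinum :: "'v \<Rightarrow> 'v \<Rightarrow> bool" where
  "equinum x y \<longleftrightarrow> (\<exists>n. n \<epsilon> Nats \<and> x \<epsilon> n \<and> y \<epsilon> n)"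

definition cardinal :: "'v \<Rightarrow> 'v" where
  "cardinal x = Coll (\<lambda>z. equinum x z)"

lemma strat_pred_included:
  "strat_term \<Gamma> (Suc t) f \<Longrightarrow> strat_term \<Gamma> (Suc t) g \<Longrightarrow> strat_pred \<Gamma> (\<lambda>e. included (f e) (g e))"
  by (rule strat_pred_subst2[where H = included], unfold included_def)
    (rule strat_intros | assumption)+

lemma strat_pred_equinum:
  "strat_term \<Gamma> t f \<Longrightarrow> strat_term \<Gamma> t g \<Longrightarrow> strat_pred \<Gamma> (\<lambda>e. equinum (f e) (g e))"
  by (rule strat_pred_subst2[where H = equinum], unfold equinum_def)
    (rule strat_intros | assumption)+

lemma strat_term_remove:
  "strat_term \<Gamma> t f \<Longrightarrow> strat_term \<Gamma> (Suc t) g \<Longrightarrow> strat_term \<Gamma> (Suc t) (\<lambda>e. remove (f e) (g e))"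
  by (rule strat_term_subst2[where H = remove], unfold remove_def) (rule strat_intros | assumption)+

lemma strat_term_singletons:
  "strat_term \<Gamma> (Suc t) f \<Longrightarrow> strat_term \<Gamma> (Suc (Suc t)) (\<lambda>e. singletons (f e))"
  by (rule strat_term_subst[where H = singletons], unfold singletons_def image_set_def)
    (rule strat_intros strat_term_single | assumption)+

lemma strat_term_power_set:
  "strat_term \<Gamma> (Suc t) f \<Longrightarrow> strat_term \<Gamma> (Suc (Suc t)) (\<lambda>e. power_set (f e))"
  by (rule strat_term_subst[where H = power_set], unfold power_set_def)
    (rule strat_intros strat_pred_included | assumption)+

lemma strat_term_cardinal: "strat_term \<Gamma> t f \<Longrightarrow> strat_term \<Gamma> (Suc t) (\<lambda>e. cardinal (f e))"
  by (rule strat_term_subst[where H = cardinal], unfold cardinal_def)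
    (rule strat_intros strat_pred_equinum | assumption)+

lemma strat_term_homogeneous:
  "homogeneous F \<Longrightarrow> strat_term \<Gamma> (Suc (Suc (Suc (Suc (Suc t))))) f \<Longrightarrow>
    strat_term \<Gamma> (Suc (Suc (Suc (Suc (Suc t))))) (\<lambda>e. F (f e))"
  by (rule strat_term_subst[where H = F]) (auto simp: homogeneous_def)

lemma included_antisym: "included x y \<Longrightarrow> included y x \<Longrightarrow> x = y"
  unfolding included_def by (intro set_ext) blast

lemma included_trans: "included x y \<Longrightarrow> included y z \<Longrightarrow> included x z"
  unfolding included_def by blast

lemma mem_empty [simp]: "\<not> x \<epsilon> empty"
  unfolding empty_def by (subst Coll_iff) (rule strat_intros | simp)+

lemma mem_single [simp]: "x \<epsilon> single a \<longleftrightarrow> x = a"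
  unfolding single_def by (subst Coll_iff) (rule strat_intros | simp)+

lemma mem_adjoin [simp]: "x \<epsilon> adjoin a y \<longleftrightarrow> x \<epsilon> y \<or> x = a"
  unfolding adjoin_def by (subst Coll_iff) (rule strat_intros | simp)+

lemma mem_remove [simp]: "x \<epsilon> remove a y \<longleftrightarrow> x \<epsilon> y \<and> x \<noteq> a"
  unfolding remove_def by (subst Coll_iff) (rule strat_intros | simp)+

lemma mem_sumset [simp]: "x \<epsilon> sumset y \<longleftrightarrow> (\<exists>z. z \<epsilon> y \<and> x \<epsilon> z)"
  unfolding sumset_def by (subst Coll_iff) (rule strat_intros | simp)+

lemma mem_zero [simp]: "x \<epsilon> zero \<longleftrightarrow> x = empty"
  by (simp add: zero_def)

lemma mem_succ: "x \<epsilon> succ n \<longleftrightarrow> (\<exists>y a. y \<epsilon> n \<and> \<not> a \<epsilon> y \<and> x = adjoin a y)"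
  unfolding succ_def by (subst Coll_iff) (rule strat_intros strat_term_adjoin | simp)+

lemma mem_V [simp]: "x \<epsilon> V"
  unfolding V_def by (subst Coll_iff) (rule strat_intros | simp)+

lemma mem_singletons [simp]: "s \<epsilon> singletons x \<longleftrightarrow> (\<exists>u. u \<epsilon> x \<and> s = single u)"
  unfolding singletons_def image_set_def by (subst Coll_iff)
    (rule strat_intros strat_term_single | simp)+

lemma mem_power_set [simp]: "u \<epsilon> power_set x \<longleftrightarrow> included u x"
  unfolding power_set_def by (subst Coll_iff) (rule strat_intros strat_pred_included | simp)+

lemma mem_image_set: "homogeneous F \<Longrightarrow> v \<epsilon> image_set F x \<longleftrightarrow> (\<exists>u. u \<epsilon> x \<and> v = F u)"
  unfolding image_set_def by (subst Coll_iff)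
    (rule strat_intros strat_term_homogeneous | assumption | simp)+

lemma mem_cardinal [simp]: "z \<epsilon> cardinal x \<longleftrightarrow> equinum x z"
  unfolding cardinal_def by (subst Coll_iff) (rule strat_intros strat_pred_equinum | simp)+

lemma eq_empty_iff: "x = empty \<longleftrightarrow> (\<forall>u. \<not> u \<epsilon> x)"
  by (auto intro: set_ext)

lemma mem_Nats: "n \<epsilon> Nats \<longleftrightarrow> (\<forall>A. zero \<epsilon> A \<and> (\<forall>m. m \<epsilon> A \<longrightarrow> succ m \<epsilon> A) \<longrightarrow> n \<epsilon> A)"
  unfolding Nats_def by (rule Coll_iff[OF Nats_set])

lemma zero_Nats [simp]: "zero \<epsilon> Nats"
  and succ_Nats [simp]: "n \<epsilon> Nats \<Longrightarrow> succ n \<epsilon> Nats"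
  by (auto simp: mem_Nats)

lemma Nats_induct [consumes 1, case_names set zero succ]:
  assumes "n \<epsilon> Nats" "is_set P" "P zero" "\<And>n. n \<epsilon> Nats \<Longrightarrow> P n \<Longrightarrow> P (succ n)"
  shows "P n"
proof -
  obtain z where z: "\<forall>x. x \<epsilon> z \<longleftrightarrow> P x" using assms(2) unfolding is_set_def by blast
  have "is_set (\<lambda>x. x \<epsilon> z \<and> x \<epsilon> Nats)" by (rule strat_intros)+
  then obtain A where A: "\<forall>x. x \<epsilon> A \<longleftrightarrow> x \<epsilon> z \<and> x \<epsilon> Nats" unfolding is_set_def by blast
  have "n \<epsilon> A"
    by (rule assms(1)[unfolded mem_Nats, rule_format]) (use A z assms(3,4) in auto)
  then show ?thesis using A z by simp
qed

lemma zero_neq_succ: "zero \<noteq> succ n"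
proof
  assume "zero = succ n"
  then have "empty \<epsilon> succ n" by (metis mem_zero)
  then show False by (metis mem_succ mem_adjoin mem_empty)
qed

lemma succ_I: "y \<epsilon> n \<Longrightarrow> \<not> a \<epsilon> y \<Longrightarrow> adjoin a y \<epsilon> succ n"
  by (auto simp: mem_succ)

text \<open>A member of \<open>succ n\<close> arises from a member of \<open>n\<close> by adding some element; it has to be
  shown that any other element serves as well. This replaces the injectivity of \<open>succ\<close>, which is
  not available before the axiom of infinity.\<close>

lemma remove_succ:
  assumes "n \<epsilon> Nats" "x \<epsilon> succ n" "a \<epsilon> x"
  shows "remove a x \<epsilon> n"
proof -
  have "\<forall>x a. x \<epsilon> succ n \<and> a \<epsilon> x \<longrightarrow> remove a x \<epsilon> n"
    using assms(1)
  proof (induction n rule: Nats_induct)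
    case set
    show ?case by (rule strat_intros strat_term_succ strat_term_remove)+
  next
    case zero
    show ?case by (auto simp: mem_succ eq_empty_iff)
  next
    case (succ n)
    show ?case
    proof (intro allI impI, elim conjE)
      fix x a
      assume "x \<epsilon> succ (succ n)" and a: "a \<epsilon> x"
      then obtain y b where y: "y \<epsilon> succ n" "\<not> b \<epsilon> y" "x = adjoin b y"
        by (auto simp: mem_succ[of _ "succ n"])
      show "remove a x \<epsilon> succ n"
      proof (cases "a = b")
        case True
        then have "remove a x = y" using y by (auto intro: set_ext)
        then show ?thesis using y by simp
      next
        case False
        then have "remove a y \<epsilon> n" using a y succ by simp
        then have "adjoin b (remove a y) \<epsilon> succ n" using y by (intro succ_I) auto
        moreover have "remove a x = adjoin b (remove a y)" using False y by (auto intro: set_ext)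
        ultimately show ?thesis by simp
      qed
    qed
  qed
  then show ?thesis using assms by blast
qed

lemma adjoin_remove: "a \<epsilon> x \<Longrightarrow> adjoin a (remove a x) = x"
  by (auto intro: set_ext)

lemma succ_E:
  assumes "x \<epsilon> succ n"
  obtains a y where "y \<epsilon> n" "\<not> a \<epsilon> y" "x = adjoin a y"
  using assms by (auto simp: mem_succ)

lemma Nats_disjoint:
  assumes "m \<epsilon> Nats" "n \<epsilon> Nats" "x \<epsilon> m" "x \<epsilon> n"
  shows "m = n"
proof -
  have cases: "n = zero \<or> (\<exists>k. k \<epsilon> Nats \<and> n = succ k)" if "n \<epsilon> Nats" for n
    using that
  proof (induction n rule: Nats_induct)
    case set
    show ?case by (rule strat_intros strat_term_succ)+
  qed auto
  have "\<forall>n x. n \<epsilon> Nats \<and> x \<epsilon> m \<and> x \<epsilon> n \<longrightarrow> m = n"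
    using assms(1)
  proof (induction m rule: Nats_induct)
    case set
    show ?case by (rule strat_intros)+
  next
    case zero
    show ?case using cases by (metis mem_adjoin mem_empty mem_zero succ_E)
  next
    case (succ m)
    show ?case
    proof (intro allI impI, elim conjE)
      fix n x
      assume n: "n \<epsilon> Nats" "x \<epsilon> n" and x: "x \<epsilon> succ m"
      obtain a where a: "a \<epsilon> x" using x by (metis mem_adjoin succ_E)
      then have "n \<noteq> zero" using n by auto
      then obtain k where k: "k \<epsilon> Nats" "n = succ k" using cases n by blast
      have "remove a x \<epsilon> m" "remove a x \<epsilon> k" using remove_succ x n k succ a by auto
      then show "succ m = n" using succ k by blast
    qed
  qed
  then show ?thesis using assms by blast
qed

lemma is_finite_equinum: "is_finite x \<longleftrightarrow> equinum x x"
  by (auto simp: is_finite_def equinum_def)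

lemma equinum_sym: "equinum x y \<Longrightarrow> equinum y x"
  by (auto simp: equinum_def)

lemma equinum_trans: "equinum x y \<Longrightarrow> equinum y z \<Longrightarrow> equinum x z"
  unfolding equinum_def using Nats_disjoint by metis

lemma cardinal_eqI: "equinum x y \<Longrightarrow> cardinal x = cardinal y"
  by (rule set_ext) (auto dest: equinum_sym equinum_trans)

lemma cardinal_eqD: "is_finite x \<Longrightarrow> cardinal x = cardinal y \<Longrightarrow> equinum y x"
  by (metis is_finite_equinum mem_cardinal)

lemma image_set_adjoin: "homogeneous F \<Longrightarrow> image_set F (adjoin a x) = adjoin (F a) (image_set F x)"
  by (rule set_ext) (auto simp: mem_image_set)

text \<open>Equinumerosity along an injection, for injections given by type-level terms.\<close>

lemma image_Nats:
  assumes F: "homogeneous F" and n: "n \<epsilon> Nats" "x \<epsilon> n"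
    and inj: "\<And>a b. a \<epsilon> x \<Longrightarrow> b \<epsilon> x \<Longrightarrow> F a = F b \<Longrightarrow> a = b"
  shows "image_set F x \<epsilon> n"
proof -
  have "\<forall>x. x \<epsilon> n \<and> (\<forall>a b. a \<epsilon> x \<and> b \<epsilon> x \<and> F a = F b \<longrightarrow> a = b) \<longrightarrow> image_set F x \<epsilon> n"
    using n(1)
  proof (induction n rule: Nats_induct)
    case set
    show ?case unfolding image_set_def by (rule strat_intros strat_term_homogeneous[OF F])+
  next
    case zero
    have "image_set F empty = empty" by (auto simp: eq_empty_iff mem_image_set[OF F])
    then show ?case by auto
  next
    case (succ n)
    show ?case
    proof (intro allI impI, elim conjE)
      fix x
      assume x: "x \<epsilon> succ n" and inj: "\<forall>a b. a \<epsilon> x \<and> b \<epsilon> x \<and> F a = F b \<longrightarrow> a = b"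
      obtain a y where y: "y \<epsilon> n" "\<not> a \<epsilon> y" "x = adjoin a y" using x by (rule succ_E)
      have "\<forall>a b. a \<epsilon> y \<and> b \<epsilon> y \<and> F a = F b \<longrightarrow> a = b"
        using inj unfolding y(3) mem_adjoin by blast
      with y(1) succ(2) have "image_set F y \<epsilon> n" by blast
      moreover have "\<not> F a \<epsilon> image_set F y"
        using inj y(2) unfolding y(3) mem_adjoin mem_image_set[OF F] by blast
      ultimately show "image_set F x \<epsilon> succ n" using y by (simp add: image_set_adjoin[OF F] succ_I)
    qed
  qed
  then show ?thesis using n inj by blast
qed

lemma equinum_image:
  assumes "homogeneous F" "is_finite x" "\<And>a b. a \<epsilon> x \<Longrightarrow> b \<epsilon> x \<Longrightarrow> F a = F b \<Longrightarrow> a = b"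
  shows "equinum x (image_set F x)"
  using assms image_Nats[of F _ x] unfolding is_finite_def equinum_def by blast

lemma is_finite_included:
  assumes "is_finite y" "included x y" shows "is_finite x"
proof -
  have "\<forall>y. y \<epsilon> n \<longrightarrow> (\<forall>x. included x y \<longrightarrow> is_finite x)" if "n \<epsilon> Nats" for n
    using that
  proof (induction n rule: Nats_induct)
    case set
    show ?case unfolding is_finite_def by (rule strat_intros strat_pred_included)+
  next
    case zero
    have "included x empty \<Longrightarrow> x = empty" for x by (auto simp: eq_empty_iff included_def)
    then show ?case by (auto simp: is_finite_def intro: exI[of _ zero])
  next
    case (succ n)
    show ?case
    proof (intro allI impI)
      fix y x
      assume y: "y \<epsilon> succ n" and x: "included x y"
      obtain a z where z: "z \<epsilon> n" "\<not> a \<epsilon> z" "y = adjoin a z" using y by (rule succ_E)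
      have "included (remove a x) z" using x z by (auto simp: included_def)
      then have d: "is_finite (remove a x)" using succ z by blast
      show "is_finite x"
      proof (cases "a \<epsilon> x")
        case True
        obtain m where "m \<epsilon> Nats" "remove a x \<epsilon> m" using d by (auto simp: is_finite_def)
        then have "succ m \<epsilon> Nats" "x \<epsilon> succ m"
          using adjoin_remove[OF True] succ_I[of "remove a x" m a] by auto
        then show ?thesis by (auto simp: is_finite_def)
      next
        case False
        then have "remove a x = x" by (auto intro: set_ext)
        then show ?thesis using d by simp
      qed
    qed
  qed
  then show ?thesis using assms unfolding is_finite_def[of y] by blast
qed

text \<open>A finite set is not equinumerous to a proper subset: remove a common element from both.\<close>

lemma equinum_included_eq:
  assumes "equinum x y" "included x y" shows "x = y"
proof -
  have "\<forall>x y. x \<epsilon> n \<and> y \<epsilon> n \<and> included x y \<longrightarrow> x = y" if "n \<epsilon> Nats" for n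
    using that
  proof (induction n rule: Nats_induct)
    case set
    show ?case by (rule strat_intros strat_pred_included)+
  next
    case (succ n)
    show ?case
    proof (intro allI impI, elim conjE)
      fix x y
      assume xy: "x \<epsilon> succ n" "y \<epsilon> succ n" "included x y"
      obtain a where a: "a \<epsilon> x" using xy(1) by (metis mem_adjoin succ_E)
      have ay: "a \<epsilon> y" using a xy by (auto simp: included_def)
      have "remove a x = remove a y"
        using succ remove_succ xy a ay by (auto simp: included_def)
      then show "x = y" using adjoin_remove a ay by metis
    qed
  qed auto
  then show ?thesis using assms unfolding equinum_def by blast
qed

text \<open>Match the elements of \<open>x\<close> one by one with elements of \<open>y\<close>, until one of the sets is
  exhausted.\<close>

lemma equinum_compare:
  assumes "is_finite x"
  shows "(\<exists>z. included z y \<and> equinum x z) \<or> (\<exists>z. included z x \<and> z \<noteq> x \<and> equinum z y)"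
proof -
  have "\<forall>x. x \<epsilon> n \<longrightarrow> (\<exists>z. included z y \<and> z \<epsilon> n) \<or> (\<exists>z. included z x \<and> z \<noteq> x \<and> equinum z y)"
    if "n \<epsilon> Nats" for n
    using that
  proof (induction n rule: Nats_induct)
    case set
    show ?case by (rule strat_intros strat_pred_included strat_pred_equinum)+
  next
    case zero
    show ?case by (auto simp: included_def)
  next
    case (succ n)
    show ?case
    proof (intro allI impI)
      fix x
      assume "x \<epsilon> succ n"
      then obtain a w where w: "w \<epsilon> n" "\<not> a \<epsilon> w" "x = adjoin a w" by (rule succ_E)
      show "(\<exists>z. included z y \<and> z \<epsilon> succ n) \<or> (\<exists>z. included z x \<and> z \<noteq> x \<and> equinum z y)"
        using succ(2)[rule_format, OF w(1)]
      proof
        assume "\<exists>z. included z y \<and> z \<epsilon> n"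
        then obtain z where z: "included z y" "z \<epsilon> n" by blast
        show ?thesis
        proof (cases "z = y")
          case True
          have "w \<noteq> x" using w by (metis mem_adjoin)
          with True have "included w x \<and> w \<noteq> x \<and> equinum w y"
            using w z succ by (auto simp: included_def equinum_def)
          then show ?thesis by blast
        next
          case False
          then obtain b where b: "b \<epsilon> y" "\<not> b \<epsilon> z" using z unfolding included_def by (metis set_ext)
          then have "included (adjoin b z) y \<and> adjoin b z \<epsilon> succ n"
            using z succ_I by (auto simp: included_def)
          then show ?thesis by blast
        qed
      next
        assume "\<exists>z. included z w \<and> z \<noteq> w \<and> equinum z y"
        then show ?thesis using w by (auto simp: included_def)
      qed
    qed
  qed
  then show ?thesis using assms unfolding is_finite_def equinum_def by metis
qed

text \<open>A proper subset of a finite set is smaller; here in the form that it embeds properly into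
  every set that is equinumerous to the whole.\<close>

lemma equinum_proper_subset:
  assumes "equinum r s" "included t r" "t \<noteq> r"
  obtains u where "included u s" "u \<noteq> s" "equinum t u"
proof -
  have t: "is_finite t" using assms is_finite_included[of r t] is_finite_equinum equinum_sym equinum_trans
    by blast
  from equinum_compare[OF t, of s] show thesis
  proof
    assume "\<exists>z. included z s \<and> equinum t z"
    then obtain z where z: "included z s" "equinum t z" by blast
    moreover have "z \<noteq> s"
      using assms z equinum_included_eq equinum_sym equinum_trans by metis
    ultimately show thesis using that by blast
  next
    assume "\<exists>z. included z t \<and> z \<noteq> t \<and> equinum z s"
    then obtain z where z: "included z t" "z \<noteq> t" "equinum z s" by blast
    have "equinum z r" using equinum_trans[OF z(3) equinum_sym[OF assms(1)]] .
    then have "z = r" using included_trans[OF z(1) assms(2)] by (rule equinum_included_eq)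
    then show thesis using z included_antisym assms(2) by blast
  qed
qed

lemma singletons_adjoin: "singletons (adjoin a x) = adjoin (single a) (singletons x)"
  by (rule set_ext) auto

lemma single_inject [simp]: "single a = single b \<longleftrightarrow> a = b"
  by (metis mem_single)

lemma sumset_single [simp]: "sumset (single a) = a"
  by (rule set_ext) auto

lemma singletons_inject: "singletons x = singletons y \<Longrightarrow> x = y"
  by (rule set_ext) (metis mem_singletons single_inject)

lemma singletons_empty [simp]: "singletons empty = empty"
  by (auto simp: eq_empty_iff)

lemma singletons_eq_adjoin:
  assumes "singletons x = adjoin s y" "\<not> s \<epsilon> y"
  obtains a where "s = single a" "a \<epsilon> x" "y = singletons (remove a x)"
proof -
  have "s \<epsilon> singletons x" using assms by simp
  then obtain a where a: "s = single a" "a \<epsilon> x" by auto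
  have "u \<epsilon> y \<longleftrightarrow> u \<epsilon> singletons x \<and> u \<noteq> s" for u using assms by auto
  moreover have "u \<epsilon> singletons (remove a x) \<longleftrightarrow> u \<epsilon> singletons x \<and> u \<noteq> s" for u using a(1) by auto
  ultimately have "y = singletons (remove a x)" by (intro set_ext) (simp only:)
  then show thesis using a that by blast
qed

text \<open>The operation \<open>T\<close> on Frege numbers, which takes the number of \<open>x\<close> to the number of the set
  of singletons of elements of \<open>x\<close>, commutes with the successor.\<close>

lemma succ_singletons:
  assumes "\<forall>y. y \<epsilon> n \<longrightarrow> singletons y \<epsilon> m" "x \<epsilon> succ n" shows "singletons x \<epsilon> succ m"
proof -
  obtain a z where "z \<epsilon> n" "\<not> a \<epsilon> z" "x = adjoin a z" using assms(2) by (rule succ_E)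
  then show ?thesis using assms(1) by (simp add: singletons_adjoin) (rule succ_I; simp)
qed

lemma equinum_singletons: assumes "equinum x y" shows "equinum (singletons x) (singletons y)"
proof -
  have "\<exists>m. m \<epsilon> Nats \<and> (\<forall>y. y \<epsilon> n \<longrightarrow> singletons y \<epsilon> m)" if "n \<epsilon> Nats" for n
    using that
  proof (induction n rule: Nats_induct)
    case set
    show ?case by (rule strat_intros strat_term_singletons)+
  next
    case zero
    show ?case by (auto intro: exI[of _ zero])
  next
    case (succ n)
    then obtain m where m: "m \<epsilon> Nats" "\<forall>y. y \<epsilon> n \<longrightarrow> singletons y \<epsilon> m" by blast
    then show ?case using succ_singletons[OF m(2)] by (intro exI[of _ "succ m"]) auto
  qed
  then show ?thesis using assms unfolding equinum_def by metis
qed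

lemma equinum_singletons_D: assumes "equinum (singletons x) (singletons y)" shows "equinum x y"
proof -
  have "\<exists>n. n \<epsilon> Nats \<and> (\<forall>y. singletons y \<epsilon> m \<longrightarrow> y \<epsilon> n)" if "m \<epsilon> Nats" for m
    using that
  proof (induction m rule: Nats_induct)
    case set
    show ?case by (rule strat_intros strat_term_singletons)+
  next
    case zero
    show ?case using singletons_inject[of _ empty] by (auto intro!: exI[of _ zero])
  next
    case (succ m)
    then obtain n where n: "n \<epsilon> Nats" "\<forall>y. singletons y \<epsilon> m \<longrightarrow> y \<epsilon> n" by blast
    have "\<forall>y. singletons y \<epsilon> succ m \<longrightarrow> y \<epsilon> succ n"
    proof (intro allI impI)
      fix y assume "singletons y \<epsilon> succ m"
      then obtain s z where z: "z \<epsilon> m" "\<not> s \<epsilon> z" "singletons y = adjoin s z" by (rule succ_E)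
      obtain a where a: "a \<epsilon> y" "z = singletons (remove a y)" using z(3,2)
        by (rule singletons_eq_adjoin)
      have "remove a y \<epsilon> n" using n z a by blast
      then have "adjoin a (remove a y) \<epsilon> succ n" by (rule succ_I) simp
      then show "y \<epsilon> succ n" using adjoin_remove a by simp
    qed
    then show ?case using n by (intro exI[of _ "succ n"]) auto
  qed
  then show ?thesis using assms unfolding equinum_def by metis
qed

definition binary_union :: "'v \<Rightarrow> 'v \<Rightarrow> 'v" where
  "binary_union x y = Coll (\<lambda>u. u \<epsilon> x \<or> u \<epsilon> y)"

lemma strat_term_binary_union:
  "strat_term \<Gamma> (Suc t) f \<Longrightarrow> strat_term \<Gamma> (Suc t) g \<Longrightarrow>
    strat_term \<Gamma> (Suc t) (\<lambda>e. binary_union (f e) (g e))"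
  by (rule strat_term_subst2[where H = binary_union], unfold binary_union_def)
    (rule strat_intros | assumption)+

lemma mem_binary_union [simp]: "u \<epsilon> binary_union x y \<longleftrightarrow> u \<epsilon> x \<or> u \<epsilon> y"
  unfolding binary_union_def by (subst Coll_iff) (rule strat_intros | simp)+

text \<open>Addition of Frege numbers.\<close>

lemma Nats_binary_union:
  assumes "m \<epsilon> Nats" "n \<epsilon> Nats"
  shows "\<exists>k. k \<epsilon> Nats \<and> (\<forall>x y. x \<epsilon> m \<and> y \<epsilon> n \<and> (\<forall>u. \<not> (u \<epsilon> x \<and> u \<epsilon> y)) \<longrightarrow> binary_union x y \<epsilon> k)"
  using assms(2)
proof (induction n rule: Nats_induct)
  case set
  show ?case by (rule strat_intros strat_term_binary_union)+
next
  case zero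
  have "binary_union x empty = x" for x by (rule set_ext) simp
  then show ?case using assms(1) by auto
next
  case (succ n)
  then obtain k where k: "k \<epsilon> Nats"
    "\<And>x y. x \<epsilon> m \<Longrightarrow> y \<epsilon> n \<Longrightarrow> (\<forall>u. \<not> (u \<epsilon> x \<and> u \<epsilon> y)) \<Longrightarrow> binary_union x y \<epsilon> k" by blast
  have "binary_union x y \<epsilon> succ k" if "x \<epsilon> m" "y \<epsilon> succ n" and d: "\<forall>u. \<not> (u \<epsilon> x \<and> u \<epsilon> y)" for x y
  proof -
    obtain a z where z: "z \<epsilon> n" "\<not> a \<epsilon> z" "y = adjoin a z" using \<open>y \<epsilon> succ n\<close> by (rule succ_E)
    have "binary_union x z \<epsilon> k" using k(2) that z by auto
    moreover have "\<not> a \<epsilon> binary_union x z" using z d by auto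
    moreover have "binary_union x y = adjoin a (binary_union x z)" using z by (auto intro: set_ext)
    ultimately show ?thesis by (simp add: succ_I)
  qed
  then show ?case using k by (intro exI[of _ "succ k"]) auto
qed

lemma homogeneous_adjoin: "homogeneous (adjoin a)"
  unfolding homogeneous_def by (intro allI) (rule strat_intros strat_term_adjoin)+

text \<open>Adding one element to \<open>z\<close> doubles the power set: the new subsets correspond to the old
  ones by \<open>u \<mapsto> u \<union> {a}\<close>.\<close>

lemma equinum_power_set: assumes "equinum x y" shows "equinum (power_set x) (power_set y)"
proof -
  have "\<exists>m. m \<epsilon> Nats \<and> (\<forall>y. y \<epsilon> n \<longrightarrow> power_set y \<epsilon> m)" if "n \<epsilon> Nats" for n
    using that
  proof (induction n rule: Nats_induct)
    case set
    show ?case by (rule strat_intros strat_term_power_set)+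
  next
    case zero
    have "power_set empty = adjoin empty empty" 
      by (rule set_ext) (auto simp: included_def eq_empty_iff)
    then have "power_set empty \<epsilon> succ zero" by (simp add: succ_I)
    then show ?case by (auto intro!: exI[of _ "succ zero"])
  next
    case (succ n)
    then obtain m where m: "m \<epsilon> Nats" "\<forall>y. y \<epsilon> n \<longrightarrow> power_set y \<epsilon> m" by blast
    obtain k where k: "k \<epsilon> Nats"
      "\<And>x y. x \<epsilon> m \<Longrightarrow> y \<epsilon> m \<Longrightarrow> (\<forall>u. \<not> (u \<epsilon> x \<and> u \<epsilon> y)) \<Longrightarrow> binary_union x y \<epsilon> k"
      using Nats_binary_union[OF m(1) m(1)] by blast
    have "\<forall>y. y \<epsilon> succ n \<longrightarrow> power_set y \<epsilon> k"
    proof (intro allI impI)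
      fix y assume "y \<epsilon> succ n"
      then obtain a z where z: "z \<epsilon> n" "\<not> a \<epsilon> z" "y = adjoin a z" by (rule succ_E)
      let ?I = "image_set (adjoin a) (power_set z)"
      have P: "power_set z \<epsilon> m" using z m by blast
      have "?I \<epsilon> m"
      proof (rule image_Nats[OF homogeneous_adjoin m(1) P])
        fix u v assume uv: "u \<epsilon> power_set z" "v \<epsilon> power_set z" "adjoin a u = adjoin a v"
        show "u = v"
        proof (rule set_ext)
          fix w
          have "w \<epsilon> adjoin a u \<longleftrightarrow> w \<epsilon> adjoin a v" using uv by simp
          then show "w \<epsilon> u \<longleftrightarrow> w \<epsilon> v" using uv(1,2) z by (auto simp: included_def)
        qed
      qed
      then have "binary_union (power_set z) ?I \<epsilon> k"
        using P z by (intro k(2)) (auto simp: mem_image_set homogeneous_adjoin included_def)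
      moreover have "power_set y = binary_union (power_set z) ?I"
      proof (rule set_ext)
        fix u
        have "\<exists>v. included v z \<and> u = adjoin a v" if "included u y" "\<not> included u z"
        proof (intro exI conjI)
          show "included (remove a u) z" using that z by (auto simp: included_def)
          have "a \<epsilon> u" using that z by (auto simp: included_def)
          then show "u = adjoin a (remove a u)" by (simp add: adjoin_remove)
        qed
        moreover have "included u y" if "included u z \<or> (\<exists>v. included v z \<and> u = adjoin a v)"
          using that z by (auto simp: included_def)
        ultimately show "u \<epsilon> power_set y \<longleftrightarrow> u \<epsilon> binary_union (power_set z) ?I"
          by (auto simp: mem_image_set homogeneous_adjoin)
      qed
      ultimately show "power_set y \<epsilon> k" by simp
    qed
    then show ?case using k by blast
  qed
  then show ?thesis using assms unfolding equinum_def by metis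
qed

lemma included_singletons: "included z (singletons x) \<Longrightarrow> z = singletons (sumset z)"
  by (rule set_ext) (force simp: included_def)

text \<open>\<open>T\<close> commutes with \<open>n \<mapsto> 2\<^sup>n\<close>. The bijection takes the singleton of \<open>u\<close> to the set of
  singletons of elements of \<open>u\<close>, which has the same type.\<close>

lemma equinum_singletons_power_set:
  assumes "is_finite (singletons (power_set y))" shows "equinum (singletons (power_set y)) (power_set (singletons y))"
proof -
  let ?F = "\<lambda>s. singletons (sumset s)"
  have F: "homogeneous ?F"
    unfolding homogeneous_def by (intro allI)
      (rule strat_intros strat_term_singletons strat_term_sumset)+
  have "equinum (singletons (power_set y)) (image_set ?F (singletons (power_set y)))"
    by (rule equinum_image[OF F assms]) (auto dest: singletons_inject)
  moreover have "image_set ?F (singletons (power_set y)) = power_set (singletons y)"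
  proof (rule set_ext)
    fix z
    have "\<exists>u. included u y \<and> z = singletons u" if "included z (singletons y)"
      using included_singletons[OF that] that
      by (intro exI[of _ "sumset z"]) (force simp: included_def)
    moreover have "included (singletons u) (singletons y)" if "included u y" for u
      using that by (auto simp: included_def)
    moreover have "z \<epsilon> image_set ?F (singletons (power_set y)) \<longleftrightarrow> (\<exists>u. included u y \<and> z = singletons u)"
      unfolding mem_image_set[OF F] by (metis mem_singletons mem_power_set sumset_single)
    ultimately show "z \<epsilon> image_set ?F (singletons (power_set y)) \<longleftrightarrow> z \<epsilon> power_set (singletons y)"
      unfolding mem_power_set by blast
  qed
  ultimately show ?thesis by simp
qed

section \<open>Parity and the axiom of infinity\<close>

definition Evens :: 'v where
  "Evens = Coll (\<lambda>n. \<forall>A. zero \<epsilon> A \<and> (\<forall>m. m \<epsilon> A \<longrightarrow> succ (succ m) \<epsilon> A) \<longrightarrow> n \<epsilon> A)"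

lemma mem_Evens:
  "n \<epsilon> Evens \<longleftrightarrow> (\<forall>A. zero \<epsilon> A \<and> (\<forall>m. m \<epsilon> A \<longrightarrow> succ (succ m) \<epsilon> A) \<longrightarrow> n \<epsilon> A)"
  unfolding Evens_def by (subst Coll_iff) (rule strat_intros strat_term_succ | simp)+

lemma zero_Evens [simp]: "zero \<epsilon> Evens"
  and succ_succ_Evens [simp]: "n \<epsilon> Evens \<Longrightarrow> succ (succ n) \<epsilon> Evens"
  by (auto simp: mem_Evens)

lemma Evens_induct [consumes 1, case_names set zero succ]:
  assumes "n \<epsilon> Evens" "is_set P" "P zero" "\<And>n. n \<epsilon> Evens \<Longrightarrow> P n \<Longrightarrow> P (succ (succ n))"
  shows "P n"
proof -
  obtain z where z: "\<forall>x. x \<epsilon> z \<longleftrightarrow> P x" using assms(2) unfolding is_set_def by blast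
  have "is_set (\<lambda>x. x \<epsilon> z \<and> x \<epsilon> Evens)" by (rule strat_intros)+
  then obtain A where A: "\<forall>x. x \<epsilon> A \<longleftrightarrow> x \<epsilon> z \<and> x \<epsilon> Evens" unfolding is_set_def by blast
  have "n \<epsilon> A"
    by (rule assms(1)[unfolded mem_Evens, rule_format]) (use A z assms(3,4) in auto)
  then show ?thesis using A z by simp
qed

lemma Evens_Nats: "n \<epsilon> Evens \<Longrightarrow> n \<epsilon> Nats"
  by (induction n rule: Evens_induct) (auto intro: is_set_bounded)

lemma Nats_Evens: "n \<epsilon> Nats \<Longrightarrow> n \<epsilon> Evens \<or> (\<exists>m. m \<epsilon> Evens \<and> n = succ m)"
proof (induction n rule: Nats_induct)
  case set
  show ?case by (rule strat_intros strat_term_succ)+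
qed auto

text \<open>No nonempty number is both even and odd. The empty set has to be excluded: if the universe
  were finite, it would be a Frege number, and its own successor.\<close>

lemma Evens_not_succ:
  assumes "n \<epsilon> Evens" "m \<epsilon> Evens" "x \<epsilon> n" shows "n \<noteq> succ m"
proof -
  have "\<forall>m x. m \<epsilon> Evens \<and> x \<epsilon> n \<longrightarrow> n \<noteq> succ m" using assms(1)
  proof (induction n rule: Evens_induct)
    case set
    show ?case by (rule strat_intros strat_term_succ)+
  next
    case zero
    show ?case by (simp add: zero_neq_succ)
  next
    case (succ n)
    show ?case
    proof (intro allI impI notI, elim conjE)
      fix m x assume m: "m \<epsilon> Evens" and x: "x \<epsilon> succ (succ n)" and eq: "succ (succ n) = succ m"
      have N: "n \<epsilon> Nats" "m \<epsilon> Nats" using succ m Evens_Nats by auto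
      obtain a y where y: "y \<epsilon> succ n" "\<not> a \<epsilon> y" "x = adjoin a y" using x by (rule succ_E)
      have "remove a x \<epsilon> succ n" "remove a x \<epsilon> m" using remove_succ N x eq y by auto
      then have sm: "succ n = m" using N Nats_disjoint by auto
      obtain b z where z: "z \<epsilon> n" "\<not> b \<epsilon> z" "y = adjoin b z" using y(1) by (rule succ_E)
      have "m = zero \<or> (\<exists>k. k \<epsilon> Evens \<and> m = succ (succ k))"
        using m
      proof (induction m rule: Evens_induct)
        case set
        show ?case by (rule strat_intros strat_term_succ)+
      qed auto
      then obtain k where k: "k \<epsilon> Evens" "m = succ (succ k)" using sm zero_neq_succ by metis
      have "remove b y \<epsilon> n" "remove b y \<epsilon> succ k"
        using remove_succ N y z k sm Evens_Nats[OF k(1)] by auto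
      then have "n = succ k" using N Nats_disjoint Evens_Nats[OF k(1)] by auto
      then show False using succ k z by blast
    qed
  qed
  then show ?thesis using assms by blast
qed

text \<open>Induction along the even numbers, as \<open>T\<close> commutes with the successor.\<close>

lemma Evens_singletons: "n \<epsilon> Evens \<Longrightarrow> \<exists>m. m \<epsilon> Evens \<and> (\<forall>y. y \<epsilon> n \<longrightarrow> singletons y \<epsilon> m)"
proof (induction n rule: Evens_induct)
  case set
  show ?case by (rule strat_intros strat_term_singletons)+
next
  case zero
  show ?case by (auto intro: exI[of _ zero])
next
  case (succ n)
  from succ obtain m where "m \<epsilon> Evens" "\<forall>y. y \<epsilon> n \<longrightarrow> singletons y \<epsilon> m" by blast
  then show ?case
    by (intro exI[of _ "succ (succ m)"]) (auto intro: succ_singletons[rotated])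
qed

lemma equinum_mem: "equinum x y \<Longrightarrow> n \<epsilon> Nats \<Longrightarrow> x \<epsilon> n \<Longrightarrow> y \<epsilon> n"
  unfolding equinum_def using Nats_disjoint by blast

text \<open>In numbers: \<open>n = T n + 1\<close> has no finite solution, as \<open>T n\<close> has the parity of \<open>n\<close>.\<close>

lemma not_equinum_singletons_adjoin:
  assumes "is_finite x" "x = adjoin a z" "\<not> a \<epsilon> z" shows "\<not> equinum (singletons x) z"
proof
  assume eq: "equinum (singletons x) z"
  obtain n where n: "n \<epsilon> Nats" "x \<epsilon> n" using assms by (auto simp: is_finite_def)
  from Nats_Evens[OF n(1)] show False
  proof
    assume e: "n \<epsilon> Evens"
    then obtain m where m: "m \<epsilon> Evens" "singletons x \<epsilon> m" using Evens_singletons n by blast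
    then have "z \<epsilon> m" using equinum_mem[OF eq] Evens_Nats by blast
    then have "x \<epsilon> succ m" using assms succ_I by simp
    then have "n = succ m" using n m Nats_disjoint Evens_Nats by simp
    then show False using Evens_not_succ e m n by blast
  next
    assume "\<exists>k. k \<epsilon> Evens \<and> n = succ k"
    then obtain k where k: "k \<epsilon> Evens" "n = succ k" by blast
    obtain m where m: "m \<epsilon> Evens" "\<forall>y. y \<epsilon> k \<longrightarrow> singletons y \<epsilon> m" using Evens_singletons k by blast
    have "singletons x \<epsilon> succ m" using succ_singletons m n k by blast
    then have "z \<epsilon> succ m" using equinum_mem[OF eq] Evens_Nats m by auto
    then have "x \<epsilon> succ (succ m)" using assms succ_I by simp
    moreover have "succ (succ m) \<epsilon> Nats" using m Evens_Nats by simp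
    ultimately have "succ (succ m) = n" using n Nats_disjoint by blast
    then have "n \<epsilon> Evens" using succ_succ_Evens[OF m(1)] by simp
    then show False using Evens_not_succ k n by blast
  qed
qed

lemma power_set_V: "power_set V = V"
  by (rule set_ext) (simp add: included_def)

text \<open>Specker's theorem, by the chain of iterated logarithms that is described at the
  beginning.\<close>

lemma V_infinite: "\<not> is_finite V"
proof
  assume "is_finite V"
  have fin: "is_finite x" for x
    by (rule is_finite_included[OF \<open>is_finite V\<close>]) (simp add: included_def)
  have card_eq: "cardinal x = cardinal y \<longleftrightarrow> equinum x y" for x y
    using cardinal_eqI cardinal_eqD fin equinum_sym by blast
  have UP: "equinum (singletons (power_set y)) (power_set (singletons y))" for y
    by (rule equinum_singletons_power_set[OF fin])

  \<comment> \<open>If \<open>2 ^ T |y| = T |x|\<close>, then \<open>|y|\<close> is in the range of \<open>T\<close>: otherwise \<open>T |V| < |y|\<close>, and so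
    \<open>T |V| = T (2 ^ T |V|) = 2 ^ T (T |V|) < 2 ^ T |y| = T |x| \<le> T |V|\<close>.\<close>
  have log: "\<exists>w. equinum (singletons w) y" if eq: "equinum (power_set y) (singletons x)" for x y
    using equinum_compare[OF fin[of y], of "singletons V"]
  proof
    assume "\<exists>z. included z (singletons V) \<and> equinum y z"
    then show ?thesis using included_singletons equinum_sym by metis
  next
    assume "\<exists>z. included z y \<and> z \<noteq> y \<and> equinum z (singletons V)"
    then obtain z where z: "included z y" "z \<noteq> y" "equinum z (singletons V)" by blast
    have "included (power_set z) (power_set y)" "power_set z \<noteq> power_set y"
    proof -
      show "included (power_set z) (power_set y)" using z by (auto simp: included_def)
      have "y \<epsilon> power_set y" by (simp add: included_def)
      moreover have "\<not> y \<epsilon> power_set z" using z included_antisym by auto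
      ultimately show "power_set z \<noteq> power_set y" by metis
    qed
    then obtain u where u: "included u (singletons x)" "u \<noteq> singletons x" "equinum (power_set z) u"
      by (rule equinum_proper_subset[OF eq])
    have "equinum (power_set z) (singletons V)"
      using equinum_trans[OF equinum_power_set[OF z(3)] equinum_sym[OF UP]]
      by (simp add: power_set_V)
    then have eq_u: "equinum u (singletons V)" using u equinum_sym equinum_trans by blast
    have sV: "included u (singletons V)" "included (singletons x) (singletons V)"
      using u by (auto simp: included_def)
    have "u = singletons V" using equinum_included_eq[OF eq_u sV(1)] .
    then have "u = singletons x" using u sV included_antisym by blast
    then show ?thesis using u by blast
  qed

  \<comment> \<open>The cardinals of \<open>power_set y\<close> and \<open>singletons y\<close> are a number and its logarithm.\<close>
  define H where "H = Coll (\<lambda>n. \<forall>A. cardinal V \<epsilon> A \<and>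
    (\<forall>y. cardinal (power_set y) \<epsilon> A \<longrightarrow> cardinal (singletons y) \<epsilon> A) \<longrightarrow> n \<epsilon> A)"
  have mem_H: "n \<epsilon> H \<longleftrightarrow> (\<forall>A. cardinal V \<epsilon> A \<and>
    (\<forall>y. cardinal (power_set y) \<epsilon> A \<longrightarrow> cardinal (singletons y) \<epsilon> A) \<longrightarrow> n \<epsilon> A)" for n
    unfolding H_def by (subst Coll_iff)
      (rule strat_intros strat_term_cardinal strat_term_power_set strat_term_singletons | simp)+
  have H_V: "cardinal V \<epsilon> H" by (auto simp: mem_H)
  have H_log: "cardinal (singletons y) \<epsilon> H" if "cardinal (power_set y) \<epsilon> H" for y
    using that unfolding mem_H by blast
  have H_induct: "P n" if "n \<epsilon> H" "is_set P" "P (cardinal V)"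
    "\<And>y. P (cardinal (power_set y)) \<Longrightarrow> P (cardinal (singletons y))" for P n
    using that unfolding mem_H is_set_def by blast

  define T where "T = (\<lambda>n. Coll (\<lambda>z. \<exists>y. y \<epsilon> n \<and> equinum z (singletons y)))"
  have T_card: "T (cardinal x) = cardinal (singletons x)" for x
  proof (rule set_ext)
    fix z
    have "z \<epsilon> T (cardinal x) \<longleftrightarrow> (\<exists>y. y \<epsilon> cardinal x \<and> equinum z (singletons y))"
      unfolding T_def by (subst Coll_iff)
        (rule strat_intros strat_pred_equinum strat_term_singletons | simp)+
    then show "z \<epsilon> T (cardinal x) \<longleftrightarrow> z \<epsilon> cardinal (singletons x)"
      using equinum_singletons equinum_sym equinum_trans fin is_finite_equinum
      by (metis mem_cardinal)
  qed
  have H_card: "\<exists>x. n = cardinal x" if "n \<epsilon> H" for n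
    using that by (rule H_induct) ((rule strat_intros strat_term_cardinal)+, auto)
  \<comment> \<open>Applying \<open>T\<close> to a step \<open>n = 2 ^ m\<close> of the chain gives the step \<open>T n = 2 ^ T m\<close>.\<close>
  have H_up: "T n \<epsilon> H" if "n \<epsilon> H" for n
    using that
  proof (rule H_induct)
    show "is_set (\<lambda>n. T n \<epsilon> H)"
      unfolding T_def
      by (rule strat_intros strat_term_cardinal strat_term_singletons strat_pred_equinum)+
    show "T (cardinal V) \<epsilon> H" using H_V H_log[of V] by (simp add: T_card power_set_V)
    fix y assume "T (cardinal (power_set y)) \<epsilon> H"
    then have "cardinal (power_set (singletons y)) \<epsilon> H" using cardinal_eqI[OF UP]
      by (simp add: T_card)
    then show "T (cardinal (singletons y)) \<epsilon> H" by (simp add: T_card H_log)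
  qed
  \<comment> \<open>Conversely, if \<open>T n\<close> has a logarithm then,
    by the remark above, it is some \<open>T m\<close>, where \<open>n = 2 ^ m\<close>.\<close>
  have H_down: "n = cardinal V \<or> (\<exists>m. m \<epsilon> H \<and> n = T m)" if "n \<epsilon> H" for n
    using that
  proof (rule H_induct)
    show "is_set (\<lambda>n. n = cardinal V \<or> (\<exists>m. m \<epsilon> H \<and> n = T m))"
      unfolding T_def
      by (rule strat_intros strat_term_cardinal strat_term_singletons strat_pred_equinum)+
    show "cardinal V = cardinal V \<or> (\<exists>m. m \<epsilon> H \<and> cardinal V = T m)" by simp
    fix y assume "cardinal (power_set y) = cardinal V \<or> (\<exists>m. m \<epsilon> H \<and> cardinal (power_set y) = T m)"
    then have "\<exists>m. m \<epsilon> H \<and> cardinal (singletons y) = T m"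
    proof
      assume "cardinal (power_set y) = cardinal V"
      then have "power_set y = V" using card_eq equinum_included_eq by (simp add: included_def)
      then have "V \<epsilon> power_set y" by simp
      then have "y = V" using included_antisym[of y V] by (simp add: included_def)
      then show ?thesis using H_V T_card by metis
    next
      assume "\<exists>m. m \<epsilon> H \<and> cardinal (power_set y) = T m"
      then obtain x where x: "cardinal x \<epsilon> H" "equinum (power_set y) (singletons x)"
        using H_card T_card card_eq by metis
      then obtain w where w: "equinum (singletons w) y" using log by blast
      have "equinum (singletons (power_set w)) (singletons x)"
        using equinum_trans[OF UP equinum_trans[OF equinum_power_set[OF w] x(2)]] .
      then have "cardinal (power_set w) = cardinal x" using equinum_singletons_D card_eq by blast
      then have "cardinal (singletons w) \<epsilon> H" using x H_log by simp
      then have "cardinal y \<epsilon> H" using w card_eq by metis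
      then show ?thesis using T_card by metis
    qed
    then show "cardinal (singletons y) = cardinal V \<or> (\<exists>m. m \<epsilon> H \<and> cardinal (singletons y) = T m)"
      by blast
  qed

  \<comment> \<open>On the singletons of elements of \<open>H\<close>, the map \<open>{n} \<mapsto> T n\<close> is type-level.\<close>
  define F where "F = (\<lambda>s. T (sumset s))"
  have F: "homogeneous F"
    unfolding homogeneous_def F_def T_def 
    by (intro allI) (rule strat_intros strat_pred_equinum strat_term_singletons strat_term_sumset)+
  define Z where "Z = image_set F (singletons H)"
  have mem_Z: "z \<epsilon> Z \<longleftrightarrow> (\<exists>n. n \<epsilon> H \<and> z = T n)" for z
    unfolding Z_def mem_image_set[OF F] mem_singletons by (auto simp: F_def)
  have "equinum (singletons H) Z" unfolding Z_def
  proof (rule equinum_image[OF F fin])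
    fix a b assume ab: "a \<epsilon> singletons H" "b \<epsilon> singletons H" "F a = F b"
    then obtain m n where mn: "m \<epsilon> H" "n \<epsilon> H" "a = single m" "b = single n" by auto
    then obtain x y where xy: "m = cardinal x" "n = cardinal y" using H_card by metis
    then have "equinum (singletons x) (singletons y)" using ab mn T_card card_eq
      by (simp add: F_def)
    then show "a = b" using equinum_singletons_D card_eq xy mn by simp
  qed
  moreover have "H = adjoin (cardinal V) Z"
    by (rule set_ext) (use mem_Z H_up H_down H_V in auto)
  moreover have "\<not> cardinal V \<epsilon> Z"
  proof
    assume "cardinal V \<epsilon> Z"
    then obtain x where "cardinal V = cardinal (singletons x)" using mem_Z H_card T_card by metis
    then have "singletons x = V" using card_eq equinum_sym equinum_included_eq
      by (simp add: included_def)
    then have "empty \<epsilon> singletons x" by simp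
    then show False by (metis mem_singletons mem_empty mem_single)
  qed
  ultimately show False using not_equinum_singletons_adjoin fin by blast
qed

text \<open>If \<open>succ m = succ n\<close>, add to a member \<open>y\<close> of \<open>m\<close> a new element and remove it again to find
  \<open>y\<close> in \<open>n\<close>. A new element exists because \<open>y\<close>, being finite, is not the universe.\<close>

lemma succ_inject:
  assumes "m \<epsilon> Nats" "n \<epsilon> Nats" "succ m = succ n" shows "m = n"
proof -
  have "included m n" if mn: "m \<epsilon> Nats" "n \<epsilon> Nats" "succ m = succ n" for m n
    unfolding included_def
  proof (intro allI impI)
    fix y assume y: "y \<epsilon> m"
    have "y \<noteq> V" using y V_infinite mn by (auto simp: is_finite_def)
    then obtain a where a: "\<not> a \<epsilon> y" by (metis set_ext mem_V)
    have "remove a (adjoin a y) \<epsilon> n"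
      using succ_I[OF y a] mn by (intro remove_succ) auto
    moreover have "remove a (adjoin a y) = y" using a by (auto intro: set_ext)
    ultimately show "y \<epsilon> n" by simp
  qed
  from this[of m n] this[of n m] assms show ?thesis
    by (intro included_antisym) simp_all
qed


section \<open>Quine pairs\<close>

lemma mem_shift_image: "u \<epsilon> shift_image a \<longleftrightarrow> (\<exists>v. v \<epsilon> a \<and> u = shift v)"
  unfolding shift_image_def by (subst Coll_iff) (rule strat_intros strat_term_shift | simp)+

lemma mem_pair: "u \<epsilon> pair x y \<longleftrightarrow> (\<exists>a. a \<epsilon> x \<and> u = shift_image a) \<or>
    (\<exists>b. b \<epsilon> y \<and> u = adjoin zero (shift_image b))"
  unfolding pair_def by (subst Coll_iff)
    (rule strat_intros strat_term_shift_image strat_term_adjoin | simp)+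

lemma shift_inject: "shift u = shift v \<Longrightarrow> u = v"
  unfolding shift_def by (metis succ_Nats succ_inject)

lemma shift_neq_zero: "shift u \<noteq> zero"
  unfolding shift_def by (metis zero_Nats zero_neq_succ)

lemma shift_image_inject: "shift_image a = shift_image b \<Longrightarrow> a = b"
  by (rule set_ext) (metis mem_shift_image shift_inject)

text \<open>As \<open>0\<close> is not a value of \<open>shift\<close>, its presence tells the two components of a pair apart.\<close>

lemma zero_notin_shift_image: "\<not> zero \<epsilon> shift_image a"
  by (metis mem_shift_image shift_neq_zero)

lemma adjoin_zero_inject:
  assumes "adjoin zero (shift_image a) = adjoin zero (shift_image b)" shows "a = b"
proof -
  have "shift_image a = remove zero (adjoin zero (shift_image a))" for a
    by (rule set_ext) (use zero_notin_shift_image in auto)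
  then show ?thesis using assms shift_image_inject by metis
qed

lemma shift_image_neq_adjoin_zero: "shift_image a \<noteq> adjoin zero x"
  by (metis mem_adjoin zero_notin_shift_image)

definition pfst :: "'v \<Rightarrow> 'v" where
  "pfst z = Coll (\<lambda>a. shift_image a \<epsilon> z)"

definition psnd :: "'v \<Rightarrow> 'v" where
  "psnd z = Coll (\<lambda>b. adjoin zero (shift_image b) \<epsilon> z)"

lemma strat_term_pfst:
  "strat_term \<Gamma> (Suc (Suc (Suc (Suc t)))) f \<Longrightarrow>
    strat_term \<Gamma> (Suc (Suc (Suc (Suc t)))) (\<lambda>e. pfst (f e))"
  by (rule strat_term_subst[where H = pfst], unfold pfst_def)
    (rule strat_intros strat_term_shift_image | assumption)+

lemma strat_term_psnd:
  "strat_term \<Gamma> (Suc (Suc (Suc (Suc t)))) f \<Longrightarrow>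
    strat_term \<Gamma> (Suc (Suc (Suc (Suc t)))) (\<lambda>e. psnd (f e))"
  by (rule strat_term_subst[where H = psnd], unfold psnd_def)
    (rule strat_intros strat_term_shift_image strat_term_adjoin | assumption)+

lemma pfst_pair [simp]: "pfst (pair x y) = x"
proof (rule set_ext)
  fix a
  have "a \<epsilon> pfst (pair x y) \<longleftrightarrow> shift_image a \<epsilon> pair x y"
    unfolding pfst_def by (subst Coll_iff) (rule strat_intros strat_term_shift_image | simp)+
  then show "a \<epsilon> pfst (pair x y) \<longleftrightarrow> a \<epsilon> x"
    using shift_image_neq_adjoin_zero shift_image_inject by (metis mem_pair)
qed

lemma psnd_pair [simp]: "psnd (pair x y) = y"
proof (rule set_ext)
  fix b
  have "b \<epsilon> psnd (pair x y) \<longleftrightarrow> adjoin zero (shift_image b) \<epsilon> pair x y"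
    unfolding psnd_def by (subst Coll_iff)
      (rule strat_intros strat_term_shift_image strat_term_adjoin | simp)+
  then show "b \<epsilon> psnd (pair x y) \<longleftrightarrow> b \<epsilon> y"
    using shift_image_neq_adjoin_zero adjoin_zero_inject by (metis mem_pair)
qed

lemma pair_inject [simp]: "pair x y = pair x' y' \<longleftrightarrow> x = x' \<and> y = y'"
  by (metis pfst_pair psnd_pair)

text \<open>The standard Frege numbers are pairwise distinct objects, which serve as indices of finite
  families.\<close>

definition tag :: "nat \<Rightarrow> 'v" where
  "tag i = (succ ^^ i) zero"

lemma tag_Nats: "tag i \<epsilon> Nats"
  by (induction i) (auto simp: tag_def)

lemma tag_inject [simp]: "tag i = tag j \<longleftrightarrow> i = j"
proof
  show "tag i = tag j \<Longrightarrow> i = j"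
  proof (induction i arbitrary: j)
    case 0
    then show ?case using zero_neq_succ by (cases j) (auto simp: tag_def)
  next
    case (Suc i)
    then show ?case using zero_neq_succ[of "tag i"] succ_inject[OF tag_Nats tag_Nats]
      by (cases j) (auto simp: tag_def)
  qed
qed simp

section \<open>Arrows as functions\<close>

text \<open>The value of the function, written as its own set of elements: as every object is a set,
  this is a stratified term for all arguments, of the same type as the argument.\<close>

definition app :: "'v \<times> 'v \<times> 'v \<Rightarrow> 'v \<Rightarrow> 'v" where
  "app h a = Coll (\<lambda>u. \<exists>b. pair a b \<epsilon> fst (snd h) \<and> u \<epsilon> b)"

definition arrow :: "'v \<Rightarrow> 'v \<Rightarrow> ('v \<Rightarrow> 'v) \<Rightarrow> 'v \<times> 'v \<times> 'v" where
  "arrow A B F = (A, Coll (\<lambda>p. \<exists>a. a \<epsilon> A \<and> p = pair a (F a)), B)"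

lemma strat_term_app:
  "strat_term \<Gamma> (Suc (Suc (Suc (Suc t)))) f \<Longrightarrow>
    strat_term \<Gamma> (Suc (Suc (Suc (Suc t)))) (\<lambda>e. app h (f e))"
  by (rule strat_term_subst[where H = "app h"], unfold app_def)
    (rule strat_intros strat_term_pair | assumption)+

lemmas homogeneous_intros = homogeneous_def[THEN iffD2, OF allI, OF allI]

lemma homogeneous_app: "homogeneous (app h)"
  by (rule homogeneous_intros) (rule strat_intros strat_term_app)+

lemma homogeneous_id: "homogeneous (\<lambda>x. x)"
  by (rule homogeneous_intros) (rule strat_intros)+

lemma homogeneous_const: "homogeneous (\<lambda>x. c)"
  by (rule homogeneous_intros) (rule strat_intros)+

lemma hom_cat_N: "h \<in> hom cat_N A B \<longleftrightarrow> (\<exists>f. h = (A, f, B) \<and> is_function A f B)"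
  by (cases h) (auto simp: hom_def cat_N_def)

lemma app_eq:
  assumes "is_function A f B" "pair a b \<epsilon> f" shows "app (A, f, B) a = b"
proof (rule set_ext)
  fix u
  have "\<exists>!b. pair a b \<epsilon> f" using assms unfolding is_function_def by (metis pair_inject)
  then have "pair a c \<epsilon> f \<longleftrightarrow> c = b" for c using assms(2) by blast
  moreover have "u \<epsilon> app (A, f, B) a \<longleftrightarrow> (\<exists>b. pair a b \<epsilon> f \<and> u \<epsilon> b)"
    unfolding app_def by (subst Coll_iff) (rule strat_intros strat_term_pair | simp)+
  ultimately show "u \<epsilon> app (A, f, B) a \<longleftrightarrow> u \<epsilon> b" by simp
qed

lemma hom_graph:
  assumes "h \<in> hom cat_N A B"
  obtains f where "h = (A, f, B)" "is_function A f B" 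
    "\<And>p. p \<epsilon> f \<longleftrightarrow> (\<exists>a. a \<epsilon> A \<and> p = pair a (app h a))"
proof -
  obtain f where f: "h = (A, f, B)" "is_function A f B" using assms hom_cat_N by blast
  have "p \<epsilon> f \<longleftrightarrow> (\<exists>a. a \<epsilon> A \<and> p = pair a (app h a))" for p
    using f(2) app_eq[OF f(2)] unfolding f(1) is_function_def by metis
  then show thesis using that f by blast
qed

lemma app_mem: "h \<in> hom cat_N A B \<Longrightarrow> a \<epsilon> A \<Longrightarrow> app h a \<epsilon> B"
  by (erule hom_graph) (metis is_function_def pair_inject)

lemma hom_eqI:
  assumes "h \<in> hom cat_N A B" "k \<in> hom cat_N A B" "\<And>a. a \<epsilon> A \<Longrightarrow> app h a = app k a"
  shows "h = k"
proof -
  obtain f where f: "h = (A, f, B)" "\<And>p. p \<epsilon> f \<longleftrightarrow> (\<exists>a. a \<epsilon> A \<and> p = pair a (app h a))"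
    using assms(1) by (rule hom_graph) blast
  obtain g where g: "k = (A, g, B)" "\<And>p. p \<epsilon> g \<longleftrightarrow> (\<exists>a. a \<epsilon> A \<and> p = pair a (app k a))"
    using assms(2) by (rule hom_graph) blast
  have "f = g" by (rule set_ext) (use f g assms(3) in auto)
  then show ?thesis using f g by simp
qed

lemma graph_arrow:
  assumes "is_set (\<lambda>p. \<exists>a. a \<epsilon> A \<and> p = pair a (F a))" "\<And>a. a \<epsilon> A \<Longrightarrow> F a \<epsilon> B"
  shows "arrow A B F \<in> hom cat_N A B" "\<And>a. a \<epsilon> A \<Longrightarrow> app (arrow A B F) a = F a"
proof -
  let ?f = "Coll (\<lambda>p. \<exists>a. a \<epsilon> A \<and> p = pair a (F a))"
  have mem: "p \<epsilon> ?f \<longleftrightarrow> (\<exists>a. a \<epsilon> A \<and> p = pair a (F a))" for p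
    using assms(1) by (rule Coll_iff)
  then have "is_function A ?f B" using assms(2) by (auto simp: is_function_def)
  then show "arrow A B F \<in> hom cat_N A B" "\<And>a. a \<epsilon> A \<Longrightarrow> app (arrow A B F) a = F a"
    using mem by (auto simp: hom_cat_N arrow_def intro!: app_eq)
qed

lemma
  assumes "homogeneous F" "\<forall>a. a \<epsilon> A \<longrightarrow> F a \<epsilon> B"
  shows arrow_hom: "arrow A B F \<in> hom cat_N A B"
    and app_arrow: "\<And>a. a \<epsilon> A \<Longrightarrow> app (arrow A B F) a = F a"
proof -
  have "is_set (\<lambda>p. \<exists>a. a \<epsilon> A \<and> p = pair a (F a))"
    by (rule strat_intros strat_term_pair strat_term_homogeneous[OF assms(1)])+
  from graph_arrow[where F = F and A = A and B = B, OF this]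
  show "arrow A B F \<in> hom cat_N A B" "\<And>a. a \<epsilon> A \<Longrightarrow> app (arrow A B F) a = F a"
    using assms(2) by simp_all
qed

lemma Ident_arrow: "Ident cat_N A = arrow A A (\<lambda>x. x)"
  by (simp add: cat_N_def arrow_def)

lemma Comp_arrow:
  assumes "f \<in> hom cat_N A B" "g \<in> hom cat_N B D"
  shows "g \<cdot>\<^bsub>cat_N\<^esub> f = arrow A D (\<lambda>a. app g (app f a))"
proof -
  obtain u where u: "f = (A, u, B)" "\<And>p. p \<epsilon> u \<longleftrightarrow> (\<exists>a. a \<epsilon> A \<and> p = pair a (app f a))"
    using assms(1) by (rule hom_graph) blast
  obtain v where v: "g = (B, v, D)" "\<And>p. p \<epsilon> v \<longleftrightarrow> (\<exists>a. a \<epsilon> B \<and> p = pair a (app g a))"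
    using assms(2) by (rule hom_graph) blast
  have "(\<exists>a b d. pair a b \<epsilon> u \<and> pair b d \<epsilon> v \<and> p = pair a d) \<longleftrightarrow>
      (\<exists>a. a \<epsilon> A \<and> p = pair a (app g (app f a)))" for p
    unfolding u(2) v(2) using app_mem[OF assms(1)] by auto
  moreover have "g \<cdot>\<^bsub>cat_N\<^esub> f = 
      (A, Coll (\<lambda>p. \<exists>a b d. pair a b \<epsilon> u \<and> pair b d \<epsilon> v \<and> p = pair a d), D)"
    unfolding u(1) v(1) by (simp add: cat_N_def)
  ultimately show ?thesis by (simp add: arrow_def)
qed

lemma homogeneous_app_app: "homogeneous (\<lambda>a. app g (app f a))"
  by (rule homogeneous_intros) (rule strat_intros strat_term_app)+

lemma Ident_N [simp]: "Ident cat_N A \<in> hom cat_N A A" "a \<epsilon> A \<Longrightarrow> app (Ident cat_N A) a = a"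
  by (auto simp: Ident_arrow arrow_hom app_arrow homogeneous_id)

lemma Comp_hom_N:
  "f \<in> hom cat_N A B \<Longrightarrow> g \<in> hom cat_N B D \<Longrightarrow> g \<cdot>\<^bsub>cat_N\<^esub> f \<in> hom cat_N A D"
  by (simp add: Comp_arrow) (intro arrow_hom homogeneous_app_app, auto intro: app_mem)

lemma app_Comp:
  "f \<in> hom cat_N A B \<Longrightarrow> g \<in> hom cat_N B D \<Longrightarrow> a \<epsilon> A \<Longrightarrow> app (g \<cdot>\<^bsub>cat_N\<^esub> f) a = app g (app f a)"
  by (simp add: Comp_arrow) (rule app_arrow[OF homogeneous_app_app], auto intro: app_mem)

lemma category_N: "category cat_N"
proof
  show "Dom cat_N f \<in> Obj cat_N" "Cod cat_N f \<in> Obj cat_N" for f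
    by (simp_all add: cat_N_def)
  show "f \<cdot>\<^bsub>cat_N\<^esub> Ident cat_N A = f" if "f \<in> hom cat_N A B" for f A B
    using that by (intro hom_eqI[OF Comp_hom_N]) (auto simp: app_Comp[OF Ident_N(1) that])
  show "Ident cat_N B \<cdot>\<^bsub>cat_N\<^esub> f = f" if "f \<in> hom cat_N A B" for f A B
    using that
    by (intro hom_eqI[OF Comp_hom_N]) (auto simp: app_Comp[OF that Ident_N(1)] app_mem)
  show "h \<cdot>\<^bsub>cat_N\<^esub> (g \<cdot>\<^bsub>cat_N\<^esub> f) = h \<cdot>\<^bsub>cat_N\<^esub> g \<cdot>\<^bsub>cat_N\<^esub> f"
    if "f \<in> hom cat_N A B" "g \<in> hom cat_N B D" "h \<in> hom cat_N D E" for f g h A B D E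
    using that
    by (intro hom_eqI[of _ A E] Comp_hom_N) 
      (auto simp: app_Comp[OF that(1)] app_Comp[OF that(2,3)] app_Comp[OF Comp_hom_N[OF that(1,2)] that(3)]
        app_Comp[OF that(1) Comp_hom_N[OF that(2,3)]] app_mem intro: Comp_hom_N)
qed (auto intro: Comp_hom_N)

text \<open>Arrows from the one-element set \<open>{\<emptyset>}\<close> are the elements of their codomain.\<close>

lemma point_hom: "a \<epsilon> A \<Longrightarrow> arrow (single empty) A (\<lambda>_. a) \<in> hom cat_N (single empty) A"
  by (rule arrow_hom[OF homogeneous_const]) simp

lemma app_point: "a \<epsilon> A \<Longrightarrow> app (arrow (single empty) A (\<lambda>_. a)) empty = a"
  by (rule app_arrow[OF homogeneous_const]) auto

lemma Comp_point:
  assumes "f \<in> hom cat_N A B" "a \<epsilon> A"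
  shows "f \<cdot>\<^bsub>cat_N\<^esub> arrow (single empty) A (\<lambda>_. a) = arrow (single empty) B (\<lambda>_. app f a)"
  using assms
  by (intro hom_eqI[OF Comp_hom_N[OF point_hom] point_hom])
    (auto simp: app_Comp[OF point_hom] app_point app_mem)

text \<open>The universal property, tested on the one-element set, shows that any pullback is in
  bijection with the pairs of elements that agree. All uses of pullbacks go through this
  description.\<close>

lemma pullback_elements:
  assumes "is_pullback cat_N f g p q"
  obtains A B Z P where "f \<in> hom cat_N A Z" "g \<in> hom cat_N B Z" "p \<in> hom cat_N P A"
    "q \<in> hom cat_N P B" "\<And>x. x \<epsilon> P \<Longrightarrow> app f (app p x) = app g (app q x)"
    "\<And>a b. a \<epsilon> A \<Longrightarrow> b \<epsilon> B \<Longrightarrow> app f a = app g b \<Longrightarrow> \<exists>x. x \<epsilon> P \<and> app p x = a \<and> app q x = b"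
    "\<And>x y. x \<epsilon> P \<Longrightarrow> y \<epsilon> P \<Longrightarrow> app p x = app p y \<Longrightarrow> app q x = app q y \<Longrightarrow> x = y"
proof -
  let ?pt = "\<lambda>A a. arrow (single empty) A (\<lambda>_. a)"
  obtain A B Z P where h: "f \<in> hom cat_N A Z" "g \<in> hom cat_N B Z" "p \<in> hom cat_N P A"
    "q \<in> hom cat_N P B" "f \<cdot>\<^bsub>cat_N\<^esub> p = g \<cdot>\<^bsub>cat_N\<^esub> q" and
    univ: "\<And>X u v. u \<in> hom cat_N X A \<Longrightarrow> v \<in> hom cat_N X B \<Longrightarrow> 
      f \<cdot>\<^bsub>cat_N\<^esub> u = g \<cdot>\<^bsub>cat_N\<^esub> v \<Longrightarrow>
      \<exists>!k. k \<in> hom cat_N X P \<and> p \<cdot>\<^bsub>cat_N\<^esub> k = u \<and> q \<cdot>\<^bsub>cat_N\<^esub> k = v"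
    using assms unfolding is_pullback_def by blast
  have comm: "app f (app p x) = app g (app q x)" if "x \<epsilon> P" for x
    using app_Comp[OF h(3,1) that] app_Comp[OF h(4,2) that] h(5) by simp
  have pts: "\<exists>!k. k \<in> hom cat_N (single empty) P \<and> p \<cdot>\<^bsub>cat_N\<^esub> k = ?pt A a \<and> q \<cdot>\<^bsub>cat_N\<^esub> k = ?pt B b"
    if "a \<epsilon> A" "b \<epsilon> B" "app f a = app g b" for a b
    using that by (intro univ point_hom) (simp_all add: Comp_point[OF h(1)] Comp_point[OF h(2)])
  have ex: "\<exists>x. x \<epsilon> P \<and> app p x = a \<and> app q x = b"
    if ab: "a \<epsilon> A" "b \<epsilon> B" "app f a = app g b" for a b
  proof -
    obtain k where k: "k \<in> hom cat_N (single empty) P"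
      "p \<cdot>\<^bsub>cat_N\<^esub> k = ?pt A a"
      "q \<cdot>\<^bsub>cat_N\<^esub> k = ?pt B b"
      using pts[OF ab] by blast
    have "app p (app k empty) = a" "app q (app k empty) = b"
      using app_Comp[OF k(1) h(3), of empty] app_Comp[OF k(1) h(4), of empty] k(2,3) ab
      by (simp_all add: app_point)
    then show ?thesis using app_mem[OF k(1), of empty] by auto
  qed
  have inj: "x = y" if xy: "x \<epsilon> P" "y \<epsilon> P" "app p x = app p y" "app q x = app q y" for x y
  proof -
    have "?pt P x = ?pt P y"
      using pts[OF app_mem[OF h(3) xy(1)] app_mem[OF h(4) xy(1)] comm[OF xy(1)]]
        point_hom[OF xy(1)] point_hom[OF xy(2)] Comp_point[OF h(3) xy(1)] Comp_point[OF h(3) xy(2)]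
        Comp_point[OF h(4) xy(1)] Comp_point[OF h(4) xy(2)] xy(3,4) by auto
    then show ?thesis using app_point xy by metis
  qed
  show thesis using that h(1-4) comm ex inj by blast
qed

section \<open>Regular epimorphisms and quotients\<close>

lemma inclusion:
  assumes "included I Q"
  shows "arrow I Q (\<lambda>x. x) \<in> hom cat_N I Q" "\<And>x. x \<epsilon> I \<Longrightarrow> app (arrow I Q (\<lambda>x. x)) x = x"
  using arrow_hom[OF homogeneous_id, of I Q] app_arrow[OF homogeneous_id, of I Q] assms
  by (auto simp: included_def)

text \<open>This is how universal properties show that a family of arrows covers its codomain.\<close>

lemma split_inclusion:
  assumes "included I Q" "k \<in> hom cat_N Q I" "arrow I Q (\<lambda>x. x) \<cdot>\<^bsub>cat_N\<^esub> k = Ident cat_N Q"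
  shows "I = Q"
proof (rule included_antisym)
  show "included Q I" unfolding included_def
    using app_Comp[OF assms(2) inclusion(1)[OF assms(1)]] inclusion(2)[OF assms(1)] assms(3)
      app_mem[OF assms(2)] Ident_N(2) by metis
qed fact

lemma corestriction:
  assumes "f \<in> hom cat_N A B" "included I B" "\<forall>a. a \<epsilon> A \<longrightarrow> app f a \<epsilon> I"
  obtains f' where "f' \<in> hom cat_N A I" "arrow I B (\<lambda>x. x) \<cdot>\<^bsub>cat_N\<^esub> f' = f"
    "\<And>a. a \<epsilon> A \<Longrightarrow> app f' a = app f a"
proof -
  note f' = arrow_hom[OF homogeneous_app[of f] assms(3)] app_arrow[OF homogeneous_app[of f] assms(3)]
  have "arrow I B (\<lambda>x. x) \<cdot>\<^bsub>cat_N\<^esub> arrow A I (app f) = f"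
    by (rule hom_eqI[OF Comp_hom_N[OF f'(1) inclusion(1)[OF assms(2)]] assms(1)])
      (simp_all add: app_Comp[OF f'(1) inclusion(1)[OF assms(2)]] f'(2) inclusion(2)[OF assms(2)] assms(3)[rule_format])
  then show thesis using that f' by blast
qed

lemma Comp_assoc_N:
  "f \<in> hom cat_N A B \<Longrightarrow> g \<in> hom cat_N B D \<Longrightarrow> h \<in> hom cat_N D E \<Longrightarrow>
    h \<cdot>\<^bsub>cat_N\<^esub> (g \<cdot>\<^bsub>cat_N\<^esub> f) = h \<cdot>\<^bsub>cat_N\<^esub> g \<cdot>\<^bsub>cat_N\<^esub> f"
  by (rule category.Comp_assoc[OF category_N])

lemma Ident_Comp_N: "f \<in> hom cat_N A B \<Longrightarrow> Ident cat_N B \<cdot>\<^bsub>cat_N\<^esub> f = f"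
  by (rule category.Ident_Comp[OF category_N])

definition surjective :: "'v \<times> 'v \<times> 'v \<Rightarrow> bool" where
  "surjective e \<longleftrightarrow> (\<forall>y. y \<epsilon> Cod cat_N e \<longrightarrow> (\<exists>x. x \<epsilon> Dom cat_N e \<and> app e x = y))"

lemma surjective_iff:
  "e \<in> hom cat_N B Q \<Longrightarrow> surjective e \<longleftrightarrow> (\<forall>y. y \<epsilon> Q \<longrightarrow> (\<exists>x. x \<epsilon> B \<and> app e x = y))"
  by (auto simp: surjective_def hom_def)

text \<open>A coequalizer \<open>e\<close> factors as a map \<open>e'\<close> onto its image followed by the inclusion \<open>m\<close> of
  the image. Then \<open>e'\<close> coequalizes as well, so it factors through \<open>e\<close> by some \<open>k\<close>; by uniqueness
  \<open>m \<cdot> k\<close> is the identity, and \<open>m\<close> is onto.\<close>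

lemma coequalizer_surjective:
  assumes "is_coequalizer cat_N p q e" shows "surjective e"
proof -
  obtain A B Q where h: "p \<in> hom cat_N A B" "q \<in> hom cat_N A B" "e \<in> hom cat_N B Q"
      "e \<cdot>\<^bsub>cat_N\<^esub> p = e \<cdot>\<^bsub>cat_N\<^esub> q" and
    univ: "\<And>X h. h \<in> hom cat_N B X \<Longrightarrow> h \<cdot>\<^bsub>cat_N\<^esub> p = h \<cdot>\<^bsub>cat_N\<^esub> q \<Longrightarrow>
           (\<exists>!k. k \<in> hom cat_N Q X \<and> k \<cdot>\<^bsub>cat_N\<^esub> e = h)"
    using assms unfolding is_coequalizer_def by blast
  define I where "I = image_set (app e) B"
  have mem_I: "y \<epsilon> I \<longleftrightarrow> (\<exists>x. x \<epsilon> B \<and> y = app e x)" for y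
    unfolding I_def by (rule mem_image_set[OF homogeneous_app])
  have I: "included I Q" using app_mem[OF h(3)] by (auto simp: included_def mem_I)
  obtain e' where e': "e' \<in> hom cat_N B I" "arrow I Q (\<lambda>x. x) \<cdot>\<^bsub>cat_N\<^esub> e' = e"
    "\<And>a. a \<epsilon> B \<Longrightarrow> app e' a = app e a"
    by (rule corestriction[OF h(3) I]) (use mem_I in blast)+
  have "e' \<cdot>\<^bsub>cat_N\<^esub> p = e' \<cdot>\<^bsub>cat_N\<^esub> q"
  proof (rule hom_eqI[OF Comp_hom_N[OF h(1) e'(1)] Comp_hom_N[OF h(2) e'(1)]])
    fix a assume a: "a \<epsilon> A"
    then have "app e (app p a) = app e (app q a)"
      using app_Comp[OF h(1,3)] app_Comp[OF h(2,3)] h(4) by metis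
    then show "app (e' \<cdot>\<^bsub>cat_N\<^esub> p) a = app (e' \<cdot>\<^bsub>cat_N\<^esub> q) a"
      using a by (simp add: app_Comp[OF h(1) e'(1)] app_Comp[OF h(2) e'(1)] e'(3) 
          app_mem[OF h(1)] app_mem[OF h(2)])
  qed
  then obtain k where k: "k \<in> hom cat_N Q I" "k \<cdot>\<^bsub>cat_N\<^esub> e = e'" using univ e'(1) by blast
  let ?i = "arrow I Q (\<lambda>x. x)"
  have "?i \<cdot>\<^bsub>cat_N\<^esub> k \<in> hom cat_N Q Q" "(?i \<cdot>\<^bsub>cat_N\<^esub> k) \<cdot>\<^bsub>cat_N\<^esub> e = e"
    using Comp_assoc_N[OF h(3) k(1) inclusion(1)[OF I]] k e' Comp_hom_N[OF k(1) inclusion(1)[OF I]]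
    by simp_all
  moreover have "Ident cat_N Q \<in> hom cat_N Q Q" "Ident cat_N Q \<cdot>\<^bsub>cat_N\<^esub> e = e"
    using Ident_Comp_N[OF h(3)] by simp_all
  ultimately have "?i \<cdot>\<^bsub>cat_N\<^esub> k = Ident cat_N Q" using univ[OF h(3,4)] by blast
  then have "I = Q" using split_inclusion[OF I k(1)] by simp
  then show ?thesis using mem_I by (auto simp: surjective_iff[OF h(3)])
qed

text \<open>A function that is constant on the fibres of a surjection \<open>e\<close> factors through \<open>e\<close>. Its
  value at \<open>y\<close> is the union of its values, all equal, on the fibre of \<open>e\<close> over \<open>y\<close>.\<close>

lemma coequalizerI:
  assumes h: "p \<in> hom cat_N K B" "q \<in> hom cat_N K B" "e \<in> hom cat_N B Q" and "surjective e"
    and comm: "\<And>x. x \<epsilon> K \<Longrightarrow> app e (app p x) = app e (app q x)"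
    and ker: "\<And>a b. a \<epsilon> B \<Longrightarrow> b \<epsilon> B \<Longrightarrow> app e a = app e b \<Longrightarrow> \<exists>x. x \<epsilon> K \<and> app p x = a \<and> app q x = b"
  shows "is_coequalizer cat_N p q e"
  unfolding is_coequalizer_def
proof (intro exI conjI allI impI)
  show "p \<in> hom cat_N K B" "q \<in> hom cat_N K B" "e \<in> hom cat_N B Q" by fact+
  show "e \<cdot>\<^bsub>cat_N\<^esub> p = e \<cdot>\<^bsub>cat_N\<^esub> q"
    by (rule hom_eqI[OF Comp_hom_N[OF h(1,3)] Comp_hom_N[OF h(2,3)]])
      (simp add: app_Comp[OF h(1,3)] app_Comp[OF h(2,3)] comm)
  have surj: "\<exists>x. x \<epsilon> B \<and> app e x = y" if "y \<epsilon> Q" for y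
    using \<open>surjective e\<close> that by (simp add: surjective_iff[OF h(3)])
  fix X g assume "g \<in> hom cat_N B X \<and> g \<cdot>\<^bsub>cat_N\<^esub> p = g \<cdot>\<^bsub>cat_N\<^esub> q"
  then have g: "g \<in> hom cat_N B X" and eq: "g \<cdot>\<^bsub>cat_N\<^esub> p = g \<cdot>\<^bsub>cat_N\<^esub> q" by auto
  have resp: "app g a = app g b" if "a \<epsilon> B" "b \<epsilon> B" "app e a = app e b" for a b
    using ker[OF that] app_Comp[OF h(1) g] app_Comp[OF h(2) g] eq by metis
  define G where "G = (\<lambda>y. Coll (\<lambda>u. \<exists>b. b \<epsilon> B \<and> app e b = y \<and> u \<epsilon> app g b))"
  have G: "G (app e b) = app g b" if "b \<epsilon> B" for b
  proof (rule set_ext)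
    fix u
    have "u \<epsilon> G (app e b) \<longleftrightarrow> (\<exists>b'. b' \<epsilon> B \<and> app e b' = app e b \<and> u \<epsilon> app g b')"
      unfolding G_def by (subst Coll_iff) (rule strat_intros strat_term_app | simp)+
    then show "u \<epsilon> G (app e b) \<longleftrightarrow> u \<epsilon> app g b" using resp that by metis
  qed
  have hG: "homogeneous G" unfolding G_def
    by (rule homogeneous_intros) (rule strat_intros strat_term_app)+
  have GX: "\<forall>y. y \<epsilon> Q \<longrightarrow> G y \<epsilon> X" using surj G app_mem[OF g] by metis
  note k = arrow_hom[OF hG GX] app_arrow[OF hG GX]
  show "\<exists>!k. k \<in> hom cat_N Q X \<and> k \<cdot>\<^bsub>cat_N\<^esub> e = g"
  proof (intro ex1I conjI)
    show "arrow Q X G \<in> hom cat_N Q X" by (rule k)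
    show "arrow Q X G \<cdot>\<^bsub>cat_N\<^esub> e = g"
      by (rule hom_eqI[OF Comp_hom_N[OF h(3) k(1)] g])
        (simp_all add: app_Comp[OF h(3) k(1)] k(2) G app_mem[OF h(3)])
    fix k' assume "k' \<in> hom cat_N Q X \<and> k' \<cdot>\<^bsub>cat_N\<^esub> e = g"
    then have k': "k' \<in> hom cat_N Q X" "k' \<cdot>\<^bsub>cat_N\<^esub> e = g" by auto
    show "k' = arrow Q X G"
    proof (rule hom_eqI[OF k'(1) k(1)])
      fix y assume y: "y \<epsilon> Q"
      then obtain x where "x \<epsilon> B" "app e x = y" using surj by blast
      then show "app k' y = app (arrow Q X G) y"
        using k(2)[OF y] G app_Comp[OF h(3) k'(1), of x] k'(2) by auto
    qed
  qed
qed

text \<open>A surjection is the coequalizer of its kernel pair.\<close>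

lemma surjective_regular_epi:
  assumes e: "e \<in> hom cat_N B Q" "surjective e" shows "regular_epi cat_N e"
proof -
  define K where "K = Coll (\<lambda>p. \<exists>a b. p = pair a b \<and> a \<epsilon> B \<and> b \<epsilon> B \<and> app e a = app e b)"
  have K: "p \<epsilon> K \<longleftrightarrow> (\<exists>a b. p = pair a b \<and> a \<epsilon> B \<and> b \<epsilon> B \<and> app e a = app e b)" for p
    unfolding K_def by (subst Coll_iff) (rule strat_intros strat_term_pair strat_term_app | simp)+
  have F: "homogeneous pfst" "homogeneous psnd"
    by (rule homogeneous_intros, (rule strat_intros strat_term_pfst strat_term_psnd)+)+
  have FB: "\<forall>x. x \<epsilon> K \<longrightarrow> pfst x \<epsilon> B" "\<forall>x. x \<epsilon> K \<longrightarrow> psnd x \<epsilon> B" using K by auto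
  note p = arrow_hom[OF F(1) FB(1)] app_arrow[OF F(1) FB(1)]
  note q = arrow_hom[OF F(2) FB(2)] app_arrow[OF F(2) FB(2)]
  have "is_coequalizer cat_N (arrow K B pfst) (arrow K B psnd) e"
  proof (rule coequalizerI[OF p(1) q(1) e])
    show "app e (app (arrow K B pfst) x) = app e (app (arrow K B psnd) x)" if "x \<epsilon> K" for x
      unfolding p(2)[OF that] q(2)[OF that] using that K by auto
    show "\<exists>x. x \<epsilon> K \<and> app (arrow K B pfst) x = a \<and> app (arrow K B psnd) x = b"
      if "a \<epsilon> B" "b \<epsilon> B" "app e a = app e b" for a b
      using that K by (intro exI[of _ "pair a b"]) (simp add: p(2) q(2))
  qed
  then show ?thesis unfolding regular_epi_def by blast
qed

lemma regular_epi_surjective: "regular_epi cat_N e \<Longrightarrow> surjective e"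
  unfolding regular_epi_def using coequalizer_surjective by blast

lemma pullback_stable_N: "has_pullback_stable_regular_epis cat_N"
  unfolding has_pullback_stable_regular_epis_def
proof (intro allI impI, elim conjE)
  fix e g p q assume e: "regular_epi cat_N e" and "is_pullback cat_N e g p q"
  from this(2) obtain A B Z P where h: "e \<in> hom cat_N A Z" "g \<in> hom cat_N B Z" "p \<in> hom cat_N P A"
    "q \<in> hom cat_N P B" and
    ex: "\<And>a b. a \<epsilon> A \<Longrightarrow> b \<epsilon> B \<Longrightarrow> app e a = app g b \<Longrightarrow> \<exists>x. x \<epsilon> P \<and> app p x = a \<and> app q x = b"
    by (rule pullback_elements) blast
  have "surjective q" unfolding surjective_iff[OF h(4)]
  proof (intro allI impI)
    fix b assume b: "b \<epsilon> B"
    then obtain a where "a \<epsilon> A" "app e a = app g b"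
      using regular_epi_surjective[OF e] app_mem[OF h(2)] by (auto simp: surjective_iff[OF h(1)])
    then show "\<exists>x. x \<epsilon> P \<and> app q x = b" using ex b by blast
  qed
  then show "regular_epi cat_N q" using surjective_regular_epi h(4) by blast
qed

text \<open>The set of equivalence classes would be of higher type than the set that it is a quotient
  of. The image of \<open>f\<close> is in bijection with it and has the right type.\<close>

lemma quotients_N: "has_quotients_of_kernel_pairs cat_N"
  unfolding has_quotients_of_kernel_pairs_def is_kernel_pair_def
proof (intro allI impI)
  fix f p q assume "is_pullback cat_N f f p q"
  then obtain A B Z P where h: "f \<in> hom cat_N A Z" "f \<in> hom cat_N B Z" "p \<in> hom cat_N P A"
    "q \<in> hom cat_N P B" and comm: "\<And>x. x \<epsilon> P \<Longrightarrow> app f (app p x) = app f (app q x)" and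
    ex: "\<And>a b. a \<epsilon> A \<Longrightarrow> b \<epsilon> B \<Longrightarrow> app f a = app f b \<Longrightarrow> \<exists>x. x \<epsilon> P \<and> app p x = a \<and> app q x = b"
    by (rule pullback_elements) blast
  have [simp]: "B = A" using h(1,2) by (auto simp: hom_def)
  define I where "I = image_set (app f) A"
  have mem_I: "y \<epsilon> I \<longleftrightarrow> (\<exists>x. x \<epsilon> A \<and> y = app f x)" for y
    unfolding I_def by (rule mem_image_set[OF homogeneous_app])
  have fI: "\<forall>a. a \<epsilon> A \<longrightarrow> app f a \<epsilon> I" using mem_I by blast
  note e = arrow_hom[OF homogeneous_app fI] app_arrow[OF homogeneous_app fI]
  have "surjective (arrow A I (app f))"
    using mem_I by (auto simp: surjective_iff[OF e(1)] e(2))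
  then have "is_coequalizer cat_N p q (arrow A I (app f))"
    using h(3,4) e(1) comm ex app_mem[OF h(3)] app_mem[OF h(4)]
    by (intro coequalizerI) (auto simp: e(2))
  then show "\<exists>e. is_coequalizer cat_N p q e" by blast
qed

section \<open>Finite limits and coproducts\<close>

lemma finite_coproducts_N: "has_finite_coproducts cat_N"
  unfolding has_finite_coproducts_def
proof (intro allI impI, elim conjE)
  fix I :: "nat set" and A :: "nat \<Rightarrow> 'v"
  assume fin: "finite I"
  define Q where "Q = Coll (\<lambda>p. \<exists>i\<in>I. \<exists>a. a \<epsilon> A i \<and> p = pair a (tag i))"
  have Q: "p \<epsilon> Q \<longleftrightarrow> (\<exists>i\<in>I. \<exists>a. a \<epsilon> A i \<and> p = pair a (tag i))" for p
    unfolding Q_def by (subst Coll_iff)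
      (rule strat_intros strat_term_pair strat_pred_finite_ex[OF fin] | simp)+
  have F: "homogeneous (\<lambda>a. pair a (tag i))" for i
    by (rule homogeneous_intros) (rule strat_intros strat_term_pair)+
  have FQ: "\<forall>a. a \<epsilon> A i \<longrightarrow> pair a (tag i) \<epsilon> Q" if "i \<in> I" for i using that Q by blast
  define inc where "inc = (\<lambda>i. arrow (A i) Q (\<lambda>a. pair a (tag i)))"
  have inc: "inc i \<in> hom cat_N (A i) Q"
    "\<And>a. a \<epsilon> A i \<Longrightarrow> app (inc i) a = pair a (tag i)" if "i \<in> I" for i
    unfolding inc_def using arrow_hom[OF F FQ[OF that]] app_arrow[OF F FQ[OF that]] by auto
  have "is_coproduct cat_N I A Q inc"
    unfolding is_coproduct_def
  proof (intro conjI ballI allI impI)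
    show "Q \<in> Obj cat_N" by (simp add: cat_N_def)
    show "inc i \<in> hom cat_N (A i) Q" if "i \<in> I" for i using inc that by blast
    fix X h assume "X \<in> Obj cat_N \<and> (\<forall>i\<in>I. h i \<in> hom cat_N (A i) X)"
    then have h: "\<And>i. i \<in> I \<Longrightarrow> h i \<in> hom cat_N (A i) X" by blast
    define G where "G = (\<lambda>p. Coll (\<lambda>u. \<exists>i\<in>I. psnd p = tag i \<and> u \<epsilon> app (h i) (pfst p)))"
    have hG: "homogeneous G" unfolding G_def
      by (rule homogeneous_intros)
        (rule strat_intros strat_term_app strat_term_pfst strat_term_psnd strat_pred_finite_ex[OF fin])+
    have G: "G (pair a (tag i)) = app (h i) a" if "i \<in> I" for a i
    proof (rule set_ext)
      fix u
      have "u \<epsilon> G (pair a (tag i)) \<longleftrightarrow> (\<exists>j\<in>I. psnd (pair a (tag i)) = tag j \<and> u \<epsilon> app (h j) (pfst (pair a (tag i))))"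
        unfolding G_def by (subst Coll_iff) (rule strat_intros strat_pred_finite_ex[OF fin] refl)+
      then show "u \<epsilon> G (pair a (tag i)) \<longleftrightarrow> u \<epsilon> app (h i) a" using that by auto
    qed
    have GX: "\<forall>p. p \<epsilon> Q \<longrightarrow> G p \<epsilon> X" using G app_mem[OF h] by (auto simp: Q)
    note k = arrow_hom[OF hG GX] app_arrow[OF hG GX]
    show "\<exists>!k. k \<in> hom cat_N Q X \<and> (\<forall>i\<in>I. k \<cdot>\<^bsub>cat_N\<^esub> inc i = h i)"
    proof (intro ex1I conjI ballI)
      show "arrow Q X G \<in> hom cat_N Q X" by (rule k)
      show "arrow Q X G \<cdot>\<^bsub>cat_N\<^esub> inc i = h i" if i: "i \<in> I" for i
        by (rule hom_eqI[OF Comp_hom_N[OF inc(1) k(1)] h])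
          (simp_all add: i app_Comp[OF inc(1)[OF i] k(1)] k(2) G inc(2) FQ[rule_format])
      fix k' assume "k' \<in> hom cat_N Q X \<and> (\<forall>i\<in>I. k' \<cdot>\<^bsub>cat_N\<^esub> inc i = h i)"
      then have k': "k' \<in> hom cat_N Q X" "\<And>i. i \<in> I \<Longrightarrow> k' \<cdot>\<^bsub>cat_N\<^esub> inc i = h i" by auto
      show "k' = arrow Q X G"
      proof (rule hom_eqI[OF k'(1) k(1)])
        fix p assume p: "p \<epsilon> Q"
        then obtain i a where ia: "i \<in> I" "a \<epsilon> A i" "p = pair a (tag i)" using Q by blast
        then have "app k' p = app (h i) a"
          using app_Comp[OF inc(1)[OF ia(1)] k'(1) ia(2)] k'(2) inc(2) by simp
        then show "app k' p = app (arrow Q X G) p" using k(2)[OF p] G ia by simp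
      qed
    qed
  qed
  then show "\<exists>Q inc. is_coproduct cat_N I A Q inc" by blast
qed

definition proj :: "nat \<Rightarrow> 'v \<Rightarrow> 'v" where
  "proj i z = Coll (\<lambda>u. pair u (tag i) \<epsilon> z)"

text \<open>A family of sets of standard finite size is coded by its disjoint union. Unlike a set of
  pairs \<open>\<langle>x i, i\<rangle>\<close>, this code has the type of the members \<open>x i\<close> of the family.\<close>

definition tuple :: "nat set \<Rightarrow> (nat \<Rightarrow> 'v) \<Rightarrow> 'v" where
  "tuple I x = Coll (\<lambda>p. \<exists>i\<in>I. \<exists>u. u \<epsilon> x i \<and> p = pair u (tag i))"

lemma mem_proj: "u \<epsilon> proj i z \<longleftrightarrow> pair u (tag i) \<epsilon> z"
  unfolding proj_def by (subst Coll_iff) (rule strat_intros strat_term_pair | simp)+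

lemma mem_tuple: "finite I \<Longrightarrow> p \<epsilon> tuple I x \<longleftrightarrow> (\<exists>i\<in>I. \<exists>u. u \<epsilon> x i \<and> p = pair u (tag i))"
  unfolding tuple_def by (subst Coll_iff)
    (rule strat_intros strat_term_pair strat_pred_finite_ex | assumption | simp)+

lemma strat_term_proj: "strat_term \<Gamma> (Suc (Suc (Suc (Suc (Suc t))))) f \<Longrightarrow> 
    strat_term \<Gamma> (Suc (Suc (Suc (Suc (Suc t))))) (\<lambda>e. proj i (f e))"
  by (rule strat_term_subst[where H = "proj i"], unfold proj_def)
    (rule strat_intros strat_term_pair | assumption)+

lemma homogeneous_proj: "homogeneous (proj i)"
  by (rule homogeneous_intros) (rule strat_intros strat_term_proj)+

lemma homogeneous_tuple:
  assumes fin: "finite I" shows "homogeneous (\<lambda>x. tuple I (\<lambda>i. app (h i) x))"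
  unfolding tuple_def
  by (rule homogeneous_intros)
    (rule strat_intros strat_term_pair strat_term_app strat_pred_finite_ex[OF fin])+

lemma proj_tuple: "finite I \<Longrightarrow> i \<in> I \<Longrightarrow> proj i (tuple I x) = x i"
  by (rule set_ext) (auto simp: mem_proj mem_tuple)

lemma tuple_proj:
  "finite I \<Longrightarrow> (\<And>p. p \<epsilon> z \<Longrightarrow> \<exists>i\<in>I. \<exists>u. p = pair u (tag i)) \<Longrightarrow> tuple I (\<lambda>i. proj i z) = z"
  by (rule set_ext) (auto simp: mem_proj mem_tuple, metis)

text \<open>The limit is the set of compatible families. It is a set because the diagram, being of
  standard finite size, imposes a finite conjunction of conditions.\<close>

lemma finite_limits_N: "has_finite_limits cat_N"
  unfolding has_finite_limits_def
proof (intro allI impI, elim conjE)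
  fix J :: "(nat, nat) cat" and Fo :: "nat \<Rightarrow> 'v" and Fa
  assume J: "category J" and fin: "finite (Obj J)"
    "finite (Arr J)" and F: "is_functor J cat_N Fo Fa"
  have Fa: "Fa u \<in> hom cat_N (Fo (Dom J u)) (Fo (Cod J u))" if "u \<in> Arr J" for u
    using F that unfolding is_functor_def by blast
  have DC: "Dom J u \<in> Obj J" "Cod J u \<in> Obj J" if "u \<in> Arr J" for u
    using category.Dom_Obj[OF J] category.Cod_Obj[OF J] that by auto
  define P where "P = (\<lambda>z. (\<forall>p. p \<epsilon> z \<longrightarrow> (\<exists>i\<in>Obj J. \<exists>u. p = pair u (tag i))) \<and>
    (\<forall>i\<in>Obj J. proj i z \<epsilon> Fo i) \<and>
    (\<forall>u\<in>Arr J. app (Fa u) (proj (Dom J u) z) = proj (Cod J u) z))"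
  define L where "L = Coll P"
  have "is_set P" unfolding P_def
    by (rule strat_intros strat_pred_finite_all[OF fin(1)] strat_pred_finite_all[OF fin(2)] strat_pred_finite_ex[OF fin(1)]
        strat_term_pair strat_term_proj strat_term_app)+
  then have L: "z \<epsilon> L \<longleftrightarrow> P z" for z unfolding L_def by (rule Coll_iff)
  have projL: "\<forall>z. z \<epsilon> L \<longrightarrow> proj i z \<epsilon> Fo i" if "i \<in> Obj J" for i
    using that L by (simp add: P_def)
  define p where "p = (\<lambda>i. arrow L (Fo i) (proj i))"
  have p: "p i \<in> hom cat_N L (Fo i)" "\<And>z. z \<epsilon> L \<Longrightarrow> app (p i) z = proj i z" if "i \<in> Obj J" for i
    unfolding p_def
    using arrow_hom[OF homogeneous_proj projL[OF that]] app_arrow[OF homogeneous_proj projL[OF that]]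
    by auto
  have "is_limit cat_N J Fo Fa L p"
    unfolding is_limit_def
  proof (intro conjI allI impI)
    show "is_cone cat_N J Fo Fa L p"
      unfolding is_cone_def
    proof (intro conjI ballI)
      show "L \<in> Obj cat_N" by (simp add: cat_N_def)
      show "p j \<in> hom cat_N L (Fo j)" if "j \<in> Obj J" for j using p that by blast
      fix u assume u: "u \<in> Arr J"
      note pd = p[OF DC(1)[OF u]] and pc = p[OF DC(2)[OF u]]
      show "Fa u \<cdot>\<^bsub>cat_N\<^esub> p (Dom J u) = p (Cod J u)"
        by (rule hom_eqI[OF Comp_hom_N[OF pd(1) Fa[OF u]] pc(1)])
          (use u L in \<open>simp add: app_Comp[OF pd(1) Fa[OF u]] pd(2) pc(2) P_def\<close>)
    qed
    fix X q assume "is_cone cat_N J Fo Fa X q"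
    then have q: "\<And>j. j \<in> Obj J \<Longrightarrow> q j \<in> hom cat_N X (Fo j)"
      and comm: "\<And>u. u \<in> Arr J \<Longrightarrow> Fa u \<cdot>\<^bsub>cat_N\<^esub> q (Dom J u) = q (Cod J u)"
      unfolding is_cone_def by auto
    let ?G = "\<lambda>x. tuple (Obj J) (\<lambda>i. app (q i) x)"
    have GL: "\<forall>x. x \<epsilon> X \<longrightarrow> ?G x \<epsilon> L"
    proof (intro allI impI, unfold L P_def, intro conjI allI impI ballI)
      fix x assume x: "x \<epsilon> X"
      show "\<exists>i\<in>Obj J. \<exists>u. p = pair u (tag i)" if "p \<epsilon> ?G x" for p
        using that by (auto simp: mem_tuple fin)
      show "proj i (?G x) \<epsilon> Fo i" if "i \<in> Obj J" for i
        using app_mem[OF q[OF that] x] that by (simp add: proj_tuple fin)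
      show "app (Fa u) (proj (Dom J u) (?G x)) = proj (Cod J u) (?G x)" if u: "u \<in> Arr J" for u
        using app_Comp[OF q[OF DC(1)[OF u]] Fa[OF u] x] comm[OF u] DC[OF u]
        by (simp add: proj_tuple fin)
    qed
    note k = arrow_hom[OF homogeneous_tuple[OF fin(1)] GL] app_arrow[OF homogeneous_tuple[OF fin(1)] GL]
    show "\<exists>!k. k \<in> hom cat_N X L \<and> (\<forall>j\<in>Obj J. p j \<cdot>\<^bsub>cat_N\<^esub> k = q j)"
    proof (intro ex1I conjI ballI)
      show "arrow X L ?G \<in> hom cat_N X L" by (rule k)
      show "p j \<cdot>\<^bsub>cat_N\<^esub> arrow X L ?G = q j" if j: "j \<in> Obj J" for j
        by (rule hom_eqI[OF Comp_hom_N[OF k(1) p(1)[OF j]] q[OF j]])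
          (simp_all add: app_Comp[OF k(1) p(1)[OF j]] k(2) p(2)[OF j] GL[rule_format] proj_tuple fin j)
      fix k' assume "k' \<in> hom cat_N X L \<and> (\<forall>j\<in>Obj J. p j \<cdot>\<^bsub>cat_N\<^esub> k' = q j)"
      then have k': "k' \<in> hom cat_N X L" "\<And>j. j \<in> Obj J \<Longrightarrow> p j \<cdot>\<^bsub>cat_N\<^esub> k' = q j" by auto
      show "k' = arrow X L ?G"
      proof (rule hom_eqI[OF k'(1) k(1)])
        fix x assume x: "x \<epsilon> X"
        have z: "app k' x \<epsilon> L" using app_mem[OF k'(1) x] .
        have pr: "proj j (app k' x) = app (q j) x" if j: "j \<in> Obj J" for j
          using app_Comp[OF k'(1) p(1)[OF j] x] k'(2)[OF j] p(2)[OF j z] by simp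
        have "app k' x = tuple (Obj J) (\<lambda>j. proj j (app k' x))"
          using z unfolding L P_def by (intro tuple_proj[symmetric] fin) blast
        also have "\<dots> = ?G x" unfolding tuple_def using pr by (auto intro!: arg_cong[where f = Coll])
        finally show "app k' x = app (arrow X L ?G) x" using k(2)[OF x] by simp
      qed
    qed
  qed
  then show "\<exists>L p. is_limit cat_N J Fo Fa L p" by blast
qed

lemma small_map_base_N: "small_map_base cat_N"
  by (intro small_map_base.intro category_N small_map_base_axioms.intro finite_limits_N
      finite_coproducts_N quotients_N pullback_stable_N)

section \<open>Strongly cantorian sets\<close>

text \<open>Let \<open>k\<close> be the set of pairs \<open>\<langle>a, {a}\<rangle>\<close> with \<open>a \<in> x\<close>. For \<open>\<langle>a, s\<rangle> \<in> k\<close>, the image \<open>F``s\<close> is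
  \<open>{F a}\<close>, and its stratified definition from \<open>s\<close> gives it the same type as \<open>F a\<close>, where \<open>a\<close> has
  the type of \<open>s\<close>. So \<open>\<langle>F a, {F a}\<rangle>\<close> is a stratified term. Comprehension is assumed for the two
  instances that are used, so that \<open>F\<close> may raise types.\<close>

lemma sc_image_general:
  assumes "strongly_cantorian x"
    and sets: "\<And>s. is_set (\<lambda>v. \<exists>u. u \<epsilon> s \<and> v = F u)"
      "\<And>k. is_set (\<lambda>p. \<exists>a s. pair a s \<epsilon> k \<and> F a \<epsilon> y \<and> p = pair (F a) (image_set F s))"
    and y: "\<And>v. v \<epsilon> y \<Longrightarrow> \<exists>u. u \<epsilon> x \<and> v = F u"
  shows "strongly_cantorian y"
proof -
  obtain k where k: "\<And>p. p \<epsilon> k \<longleftrightarrow> (\<exists>u. u \<epsilon> x \<and> p = pair u (single u))"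
    using assms(1) unfolding strongly_cantorian_def is_set_def by blast
  have im: "image_set F (single a) = single (F a)" for a
    unfolding image_set_def by (rule set_ext) (subst Coll_iff[OF sets(1)], simp)
  have "(\<exists>a s. pair a s \<epsilon> k \<and> F a \<epsilon> y \<and> p = pair (F a) (image_set F s)) \<longleftrightarrow>
      (\<exists>v. v \<epsilon> y \<and> p = pair v (single v))" for p
    unfolding k by (auto simp: im dest: y)
  then show ?thesis using sets(2)[of k] unfolding strongly_cantorian_def by simp
qed

lemma sc_image:
  assumes "strongly_cantorian x" "homogeneous F" "\<And>v. v \<epsilon> y \<Longrightarrow> \<exists>u. u \<epsilon> x \<and> v = F u"
  shows "strongly_cantorian y"
proof (rule sc_image_general[OF assms(1) _ _ assms(3)])
  show "is_set (\<lambda>v. \<exists>u. u \<epsilon> s \<and> v = F u)" for s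
    by (rule strat_intros strat_term_homogeneous[OF assms(2)])+
  show "is_set (\<lambda>p. \<exists>a s. pair a s \<epsilon> k \<and> F a \<epsilon> y \<and> p = pair (F a) (image_set F s))" for k
    unfolding image_set_def
    by (rule strat_intros strat_term_pair strat_term_homogeneous[OF assms(2)])+
qed

lemma sc_subset: "strongly_cantorian x \<Longrightarrow> included y x \<Longrightarrow> strongly_cantorian y"
  by (erule sc_image[OF _ homogeneous_id]) (auto simp: included_def)

text \<open>The inverse of an injection is again a type-level map.\<close>

lemma sc_inj:
  assumes "strongly_cantorian x" "homogeneous G" "\<And>v. v \<epsilon> y \<Longrightarrow> G v \<epsilon> x"
    "\<And>v w. v \<epsilon> y \<Longrightarrow> w \<epsilon> y \<Longrightarrow> G v = G w \<Longrightarrow> v = w"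
  shows "strongly_cantorian y"
proof -
  define F where "F = (\<lambda>a. Coll (\<lambda>u. \<exists>v. v \<epsilon> y \<and> G v = a \<and> u \<epsilon> v))"
  have F: "homogeneous F" unfolding F_def
    by (rule homogeneous_intros) (rule strat_intros strat_term_homogeneous[OF assms(2)])+
  have "F (G v) = v" if "v \<epsilon> y" for v
  proof (rule set_ext)
    fix u
    have "u \<epsilon> F (G v) \<longleftrightarrow> (\<exists>w. w \<epsilon> y \<and> G w = G v \<and> u \<epsilon> w)"
      unfolding F_def by (subst Coll_iff)
        (rule strat_intros strat_term_homogeneous[OF assms(2)] | simp)+
    then show "u \<epsilon> F (G v) \<longleftrightarrow> u \<epsilon> v" using assms(4) that by metis
  qed
  then show ?thesis using assms(3) by (intro sc_image[OF assms(1) F]) metis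
qed

lemma sc_subsingleton:
  assumes "\<And>u v. u \<epsilon> x \<Longrightarrow> v \<epsilon> x \<Longrightarrow> u = v" shows "strongly_cantorian x"
proof (cases "\<exists>a. a \<epsilon> x")
  case True
  then obtain a where "u \<epsilon> x \<longleftrightarrow> u = a" for u using assms by blast
  then have "(\<exists>y. y \<epsilon> x \<and> p = pair y (single y)) \<longleftrightarrow> p = pair a (single a)" for p by auto
  moreover have "is_set (\<lambda>p. p = pair a (single a))" by (rule strat_intros)+
  ultimately show ?thesis unfolding strongly_cantorian_def by simp
next
  case False
  moreover have "is_set (\<lambda>p. False)" by (rule strat_intros)+
  ultimately show ?thesis unfolding strongly_cantorian_def by simp
qed

lemma sc_binary_union:
  assumes "strongly_cantorian x"
    "strongly_cantorian y" shows "strongly_cantorian (binary_union x y)"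
proof -
  obtain k l where kl: "\<forall>p. p \<epsilon> k \<longleftrightarrow> (\<exists>u. u \<epsilon> x \<and> p = pair u (single u))"
    "\<forall>p. p \<epsilon> l \<longleftrightarrow> (\<exists>u. u \<epsilon> y \<and> p = pair u (single u))"
    using assms unfolding strongly_cantorian_def is_set_def by blast
  then have "\<forall>p. p \<epsilon> binary_union k l \<longleftrightarrow> (\<exists>u. u \<epsilon> binary_union x y \<and> p = pair u (single u))" by auto
  then show ?thesis unfolding strongly_cantorian_def is_set_def by blast
qed

section \<open>Strongly cantorian maps\<close>

lemma mem_fibre:
  assumes "h \<in> hom cat_N A B"
  shows "u \<epsilon> fibre h b \<longleftrightarrow> u \<epsilon> A \<and> app h u = b"
proof -
  obtain f where f: "h = (A, f, B)" "\<And>p. p \<epsilon> f \<longleftrightarrow> (\<exists>a. a \<epsilon> A \<and> p = pair a (app h a))"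
    using assms by (rule hom_graph) blast
  have "is_set (\<lambda>a. a \<epsilon> A \<and> pair a b \<epsilon> f)" by (rule strat_intros strat_term_pair)+
  then have "u \<epsilon> fibre h b \<longleftrightarrow> u \<epsilon> A \<and> pair u b \<epsilon> f"
    unfolding fibre_def f(1) by (simp add: Coll_iff)
  then show ?thesis by (auto simp: f(2))
qed

lemma fibre_eq: "h \<in> hom cat_N A B \<Longrightarrow> fibre h b = Coll (\<lambda>u. u \<epsilon> A \<and> app h u = b)"
  by (rule set_ext) (simp add: mem_fibre, subst Coll_iff, (rule strat_intros strat_term_app | simp)+)

lemma sc_map_iff:
  "h \<in> hom cat_N A B \<Longrightarrow> h \<in> strongly_cantorian_maps \<longleftrightarrow> (\<forall>b. b \<epsilon> B \<longrightarrow> strongly_cantorian (fibre h b))"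
  by (auto simp: strongly_cantorian_maps_def hom_def)

lemma sc_map_hom:
  "h \<in> strongly_cantorian_maps \<Longrightarrow> h \<in> hom cat_N (Dom cat_N h) (Cod cat_N h)"
  by (simp add: strongly_cantorian_maps_def hom_def)

text \<open>The fibres have at most one element. This covers identities and diagonals, which are split
  monomorphisms.\<close>

lemma sc_map_injective:
  assumes "h \<in> hom cat_N A B" "\<And>x y. x \<epsilon> A \<Longrightarrow> y \<epsilon> A \<Longrightarrow> app h x = app h y \<Longrightarrow> x = y"
  shows "h \<in> strongly_cantorian_maps"
  unfolding sc_map_iff[OF assms(1)]
  by (intro allI impI sc_subsingleton) (auto simp: mem_fibre[OF assms(1)] intro: assms(2))

text \<open>The map \<open>b \<mapsto> f\<^sup>-\<^sup>1(b)\<close> raises types by one, hence the appeal to the general lemma on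
  images.\<close>

lemma sc_map_Comp:
  assumes SCU and f: "f \<in> hom cat_N A B" "f \<in> strongly_cantorian_maps"
    and g: "g \<in> hom cat_N B D" "g \<in> strongly_cantorian_maps"
  shows "g \<cdot>\<^bsub>cat_N\<^esub> f \<in> strongly_cantorian_maps"
  unfolding sc_map_iff[OF Comp_hom_N[OF f(1) g(1)]]
proof (intro allI impI)
  fix d assume d: "d \<epsilon> D"
  let ?X = "fibre g d"
  let ?G = "\<lambda>b. Coll (\<lambda>u. u \<epsilon> A \<and> app f u = b)"
  define Y where "Y = image_set ?G ?X"
  have set: "is_set (\<lambda>v. \<exists>u. u \<epsilon> s \<and> v = ?G u)" for s by (rule strat_intros strat_term_app)+
  have Y: "v \<epsilon> Y \<longleftrightarrow> (\<exists>b. b \<epsilon> ?X \<and> v = fibre f b)" for v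
    unfolding Y_def image_set_def by (simp add: Coll_iff[OF set] fibre_eq[OF f(1)])
  have "strongly_cantorian Y"
  proof (rule sc_image_general[where F = ?G])
    show "strongly_cantorian ?X" using g d sc_map_iff by blast
    show "is_set (\<lambda>v. \<exists>u. u \<epsilon> s \<and> v = ?G u)" for s by (rule set)
    show "is_set (\<lambda>p. \<exists>a s. pair a s \<epsilon> k \<and> ?G a \<epsilon> Y \<and> p = pair (?G a) (image_set ?G s))" for k
      unfolding image_set_def by (rule strat_intros strat_term_pair strat_term_app)+
    show "\<exists>u. u \<epsilon> ?X \<and> v = ?G u" if "v \<epsilon> Y" for v
      using that Y fibre_eq[OF f(1)] by auto
  qed
  moreover have "strongly_cantorian y" if "y \<epsilon> Y" for y
    using that f Y sc_map_iff[OF f(1)] by (auto simp: mem_fibre[OF g(1)])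
  ultimately have "strongly_cantorian (sumset Y)" using \<open>SCU\<close> unfolding SCU_def by blast
  moreover have "sumset Y = fibre (g \<cdot>\<^bsub>cat_N\<^esub> f) d"
  proof (rule set_ext)
    fix u
    have "u \<epsilon> sumset Y \<longleftrightarrow> (\<exists>b. b \<epsilon> ?X \<and> u \<epsilon> fibre f b)"
      unfolding mem_sumset Y by blast
    then show "u \<epsilon> sumset Y \<longleftrightarrow> u \<epsilon> fibre (g \<cdot>\<^bsub>cat_N\<^esub> f) d"
      unfolding mem_fibre[OF f(1)] mem_fibre[OF g(1)] mem_fibre[OF Comp_hom_N[OF f(1) g(1)]]
      using app_Comp[OF f(1) g(1), of u] app_mem[OF f(1), of u] by metis
  qed
  ultimately show "strongly_cantorian (fibre (g \<cdot>\<^bsub>cat_N\<^esub> f) d)" by simp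
qed

text \<open>The fibre of \<open>q\<close> over \<open>b\<close> embeds, by \<open>p\<close>, into the fibre of \<open>f\<close> over \<open>g b\<close>.\<close>

lemma sc_map_pullback:
  assumes "f \<in> strongly_cantorian_maps" "is_pullback cat_N f g p q"
  shows "q \<in> strongly_cantorian_maps"
proof -
  obtain A B Z P where h: "f \<in> hom cat_N A Z" "g \<in> hom cat_N B Z" "p \<in> hom cat_N P A"
    "q \<in> hom cat_N P B" and comm: "\<And>x. x \<epsilon> P \<Longrightarrow> app f (app p x) = app g (app q x)"
    and inj: "\<And>x y. x \<epsilon> P \<Longrightarrow> y \<epsilon> P \<Longrightarrow> app p x = app p y \<Longrightarrow> app q x = app q y \<Longrightarrow> x = y"
    using assms(2) by (rule pullback_elements) blast
  show ?thesis unfolding sc_map_iff[OF h(4)]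
  proof (intro allI impI)
    fix b assume "b \<epsilon> B"
    then have "strongly_cantorian (fibre f (app g b))"
      using assms(1) sc_map_iff[OF h(1)] app_mem[OF h(2)] by blast
    then show "strongly_cantorian (fibre q b)"
      by (rule sc_inj[OF _ homogeneous_app[of p]])
        (auto simp: mem_fibre[OF h(1)] mem_fibre[OF h(4)] comm app_mem[OF h(3)] intro: inj)
  qed
qed

text \<open>The fibre of \<open>f\<close> is the image under \<open>e\<close> of the fibre of \<open>f \<cdot> e\<close>, as \<open>e\<close> is onto.\<close>

lemma sc_map_quotient:
  assumes h: "e \<in> hom cat_N A B" "f \<in> hom cat_N B Z" "regular_epi cat_N e"
    "f \<cdot>\<^bsub>cat_N\<^esub> e \<in> strongly_cantorian_maps"
  shows "f \<in> strongly_cantorian_maps"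
  unfolding sc_map_iff[OF h(2)]
proof (intro allI impI)
  fix z assume "z \<epsilon> Z"
  then have "strongly_cantorian (fibre (f \<cdot>\<^bsub>cat_N\<^esub> e) z)"
    using h(4) sc_map_iff[OF Comp_hom_N[OF h(1,2)]] by blast
  then show "strongly_cantorian (fibre f z)"
  proof (rule sc_image[OF _ homogeneous_app[of e]])
    fix b assume "b \<epsilon> fibre f z"
    then have b: "b \<epsilon> B" "app f b = z" by (auto simp: mem_fibre[OF h(2)])
    then obtain a where "a \<epsilon> A" "app e a = b"
      using regular_epi_surjective[OF h(3)] by (auto simp: surjective_iff[OF h(1)])
    then show "\<exists>u. u \<epsilon> fibre (f \<cdot>\<^bsub>cat_N\<^esub> e) z \<and> b = app e u"
      using b by (auto simp: mem_fibre[OF Comp_hom_N[OF h(1,2)]] app_Comp[OF h(1,2)])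
  qed
qed

text \<open>The union \<open>I\<close> of the two images receives maps from both summands, hence from the
  coproduct; by uniqueness the inclusion of \<open>I\<close> is split, so \<open>I\<close> is everything.\<close>

lemma coproduct_cover:
  assumes "is_binary_coproduct cat_N A B Q i j" "y \<epsilon> Q"
  shows "(\<exists>a. a \<epsilon> A \<and> y = app i a) \<or> (\<exists>b. b \<epsilon> B \<and> y = app j b)"
proof -
  have h: "i \<in> hom cat_N A Q" "j \<in> hom cat_N B Q" and
    univ: "\<And>X u v. u \<in> hom cat_N A X \<Longrightarrow> v \<in> hom cat_N B X \<Longrightarrow>
        (\<exists>!k. k \<in> hom cat_N Q X \<and> k \<cdot>\<^bsub>cat_N\<^esub> i = u \<and> k \<cdot>\<^bsub>cat_N\<^esub> j = v)"
    using assms(1) unfolding is_binary_coproduct_def by blast+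
  define I where "I = binary_union (image_set (app i) A) (image_set (app j) B)"
  have mem_I: "y \<epsilon> I \<longleftrightarrow> (\<exists>a. a \<epsilon> A \<and> y = app i a) \<or> (\<exists>b. b \<epsilon> B \<and> y = app j b)" for y
    unfolding I_def mem_binary_union mem_image_set[OF homogeneous_app] ..
  have I: "included I Q" using app_mem[OF h(1)] app_mem[OF h(2)] by (auto simp: included_def mem_I)
  let ?m = "arrow I Q (\<lambda>x. x)"
  obtain i' where i': "i' \<in> hom cat_N A I" "?m \<cdot>\<^bsub>cat_N\<^esub> i' = i"
    by (rule corestriction[OF h(1) I]) (use mem_I in blast)+
  obtain j' where j': "j' \<in> hom cat_N B I" "?m \<cdot>\<^bsub>cat_N\<^esub> j' = j"
    by (rule corestriction[OF h(2) I]) (use mem_I in blast)+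
  obtain k where k: "k \<in> hom cat_N Q I" "k \<cdot>\<^bsub>cat_N\<^esub> i = i'" "k \<cdot>\<^bsub>cat_N\<^esub> j = j'"
    using univ[OF i'(1) j'(1)] by blast
  note m = inclusion(1)[OF I]
  have "?m \<cdot>\<^bsub>cat_N\<^esub> k \<in> hom cat_N Q Q"
    "(?m \<cdot>\<^bsub>cat_N\<^esub> k) \<cdot>\<^bsub>cat_N\<^esub> i = i"
    "(?m \<cdot>\<^bsub>cat_N\<^esub> k) \<cdot>\<^bsub>cat_N\<^esub> j = j"
    using Comp_assoc_N[OF h(1) k(1) m] Comp_assoc_N[OF h(2) k(1) m] k i' j' Comp_hom_N[OF k(1) m]
    by simp_all
  moreover have "Ident cat_N Q \<in> hom cat_N Q Q"
    "Ident cat_N Q \<cdot>\<^bsub>cat_N\<^esub> i = i"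
    "Ident cat_N Q \<cdot>\<^bsub>cat_N\<^esub> j = j"
    using Ident_Comp_N[OF h(1)] Ident_Comp_N[OF h(2)] by simp_all
  ultimately have "?m \<cdot>\<^bsub>cat_N\<^esub> k = Ident cat_N Q" using univ[OF h] by blast
  then have "I = Q" using split_inclusion[OF I k(1)] by simp
  then show ?thesis using mem_I assms(2) by blast
qed

text \<open>The fibre of the copair is covered by the images of the fibres of \<open>f\<close> and \<open>g\<close>.\<close>

lemma sc_map_copair:
  assumes f: "f \<in> strongly_cantorian_maps" "f \<in> hom cat_N A Z"
    and g: "g \<in> strongly_cantorian_maps" "g \<in> hom cat_N B Z"
    and Q: "is_binary_coproduct cat_N A B Q i j"
    and h: "h \<in> hom cat_N Q Z" "h \<cdot>\<^bsub>cat_N\<^esub> i = f" "h \<cdot>\<^bsub>cat_N\<^esub> j = g"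
  shows "h \<in> strongly_cantorian_maps"
  unfolding sc_map_iff[OF h(1)]
proof (intro allI impI)
  have ij: "i \<in> hom cat_N A Q" "j \<in> hom cat_N B Q"
    using Q unfolding is_binary_coproduct_def by blast+
  fix z assume z: "z \<epsilon> Z"
  let ?U = "image_set (app i) (fibre f z)" and ?V = "image_set (app j) (fibre g z)"
  have "strongly_cantorian ?U"
    by (rule sc_image[OF f(1)[unfolded sc_map_iff[OF f(2)], rule_format, OF z] homogeneous_app[of i]])
      (simp add: mem_image_set[OF homogeneous_app])
  moreover have "strongly_cantorian ?V"
    by (rule sc_image[OF g(1)[unfolded sc_map_iff[OF g(2)], rule_format, OF z] homogeneous_app[of j]])
      (simp add: mem_image_set[OF homogeneous_app])
  ultimately have "strongly_cantorian (binary_union ?U ?V)" by (rule sc_binary_union)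
  moreover have "included (fibre h z) (binary_union ?U ?V)"
    unfolding included_def
  proof (intro allI impI)
    fix y assume "y \<epsilon> fibre h z"
    then have y: "y \<epsilon> Q" "app h y = z" by (auto simp: mem_fibre[OF h(1)])
    from coproduct_cover[OF Q y(1)] show "y \<epsilon> binary_union ?U ?V"
      using y(2) app_Comp[OF ij(1) h(1)] app_Comp[OF ij(2) h(1)] h(2,3)
      by (auto simp: mem_image_set[OF homogeneous_app] mem_fibre[OF f(2)] mem_fibre[OF g(2)])
  qed
  ultimately show "strongly_cantorian (fibre h z)" by (rule sc_subset)
qed

lemma system_of_small_maps_N:
  assumes SCU shows "system_of_small_maps cat_N strongly_cantorian_maps"
proof (intro system_of_small_maps.intro small_map_base_N system_of_small_maps_axioms.intro)
  show "strongly_cantorian_maps \<subseteq> Arr cat_N" by (auto simp: strongly_cantorian_maps_def)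
  show "Ident cat_N A \<in> strongly_cantorian_maps" for A
    by (rule sc_map_injective[OF Ident_N(1)]) simp
  show "g \<cdot>\<^bsub>cat_N\<^esub> f \<in> strongly_cantorian_maps"
    if "f \<in> strongly_cantorian_maps"
      "g \<in> strongly_cantorian_maps"
      "Cod cat_N f = Dom cat_N g" for f g
    using sc_map_Comp[OF assms sc_map_hom[OF that(1)] that(1) _ that(2)] sc_map_hom[OF that(2)] that(3)
    by simp
  show "d \<in> strongly_cantorian_maps"
    if d: "is_binary_product cat_N A A P p q"
      "d \<in> hom cat_N A P"
      "p \<cdot>\<^bsub>cat_N\<^esub> d = Ident cat_N A" for A P p q d
  proof (rule sc_map_injective[OF d(2)])
    have p: "p \<in> hom cat_N P A" using d(1) unfolding is_binary_product_def by blast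
    show "x = y" if "x \<epsilon> A" "y \<epsilon> A" "app d x = app d y" for x y
      using app_Comp[OF d(2) p] d(3) that Ident_N(2) by metis
  qed
qed (rule sc_map_pullback sc_map_quotient sc_map_copair; assumption)+

end

theorem theorem29:
  fixes mem :: "'v \<Rightarrow> 'v \<Rightarrow> bool"
  assumes "NF mem"
    and "membership.SCU mem"
  shows "system_of_small_maps (membership.cat_N mem) (membership.strongly_cantorian_maps mem)"
  using NF.system_of_small_maps_N[OF assms] .

end
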